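(* Let $d \ge 2$ be an integer. There exists a constant $c_d>0$, depending only on $d$, such that for every convex body $K \subseteq \mathbb{R}^d$ and every $\varepsilon>0$ the following holds: if the width of $K$ in every direction is at least $\varepsilon$, then there exists a polytope $P$ with $K \subseteq P$ and Hausdorff distance between $K$ and $P$ at most $\varepsilon$, whose number of facets is at most \[ \left(\frac{c_d\,\Delta_{d-1}}{\varepsilon}\right)^{\frac{d-1}{2}}, \] where $\Delta_{d-1}$ is the surface diameter of $K$.
   Context: A convex body is a compact convex set with nonempty interior. The width of $K$ in direction $u$ (a unit vector) is the distance between the two supporting hyperplanes of $K$ orthogonal to $u$. The surface diameter $\Delta_{d-1}$ of $K$ is the diameter of a Euclidean ball in $\mathbb{R}^d$ whose surface area equals the surface area of $K$ (the $(d-1)$-dimensional Hausdorff measure of $\partial K$). *)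

theory Defs
  imports "HOL-Analysis.Analysis"
begin

definition convex_body :: "'a::euclidean_space set \<Rightarrow> bool" where
  "convex_body K \<longleftrightarrow> compact K \<and> convex K \<and> interior K \<noteq> {}"

text \<open>Width of K in direction u (u a unit vector): distance between the two
  supporting hyperplanes orthogonal to u.\<close>
definition width :: "'a::euclidean_space set \<Rightarrow> 'a \<Rightarrow> real" where
  "width K u = (SUP x\<in>K. u \<bullet> x) - (INF x\<in>K. u \<bullet> x)"

text \<open>Hausdorff distance of two (nonempty, bounded) sets.\<close>
definition hausdorff_dist :: "'a::metric_space set \<Rightarrow> 'a set \<Rightarrow> real" where
  "hausdorff_dist A B =
     max (SUP x\<in>A. setdist {x} B) (SUP y\<in>B. setdist {y} A)"

text \<open>s-dimensional Hausdorff measure, normalised by the volume of the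
  s-dimensional unit ball (so that it agrees with surface area for s = d-1).\<close>
definition hausdorff_pre :: "real \<Rightarrow> real \<Rightarrow> 'a::metric_space set \<Rightarrow> ennreal" where
  "hausdorff_pre s \<delta> A =
     (INF C \<in> {C :: nat \<Rightarrow> 'a set. A \<subseteq> (\<Union>i. C i) \<and> (\<forall>i. bounded (C i) \<and> diameter (C i) \<le> \<delta>)}.
        (\<Sum>i. ennreal (unit_ball_vol s * (diameter (C i) / 2) powr s)))"

definition hausdorff_measure :: "real \<Rightarrow> 'a::metric_space set \<Rightarrow> ennreal" where
  "hausdorff_measure s A = (SUP \<delta>\<in>{0<..}. hausdorff_pre s \<delta> A)"

definition surface_area :: "'a::euclidean_space set \<Rightarrow> ennreal" where
  "surface_area K = hausdorff_measure (real DIM('a) - 1) (frontier K)"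

definition surface_diameter :: "'a::euclidean_space set \<Rightarrow> real" where
  "surface_diameter K =
     (THE D. D \<ge> 0 \<and> surface_area (ball (0::'a) (D / 2)) = surface_area K)"

end

theory Submission
  imports Defs
begin

text \<open>
  Fatten the body \<open>K\<close> by \<open>\<delta> = \<alpha>\<epsilon>\<close>. It suffices to separate from the fattened body every point
  \<open>p = k + \<epsilon>u\<close> with \<open>k \<in> K\<close> and \<open>u\<close> a unit outer normal at \<open>k\<close>. The cap that the supporting
  hyperplane at \<open>k\<close> cuts off the fattened body is comparable to a box with side lengths \<open>r\<^sub>i \<ge> \<delta>\<close>,
  and the pairs \<open>(v, s)\<close> describing half-spaces \<open>{y. v \<bullet> y \<le> s}\<close> that contain the fattened body
  but not \<open>p\<close> contain a slab over a box with side lengths of order \<open>\<delta> / r\<^sub>i\<close>. Hence the volumes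
  of the cap and of the slab are inversely proportional, with \<open>R = \<Prod>r\<^sub>i\<close>.

  If \<open>R\<close> is large, take a maximal family of caps with disjoint Macbeath regions: they lie in the
  shell between \<open>K\<close> and the fattened body, and whenever two such regions meet, the supporting
  half-space of one cap separates the point of the other. If \<open>R\<close> is small, do the same in the
  space of half-spaces, where all slabs lie in a set of volume \<open>O(\<epsilon>)\<close>. Balancing the two counts
  at \<open>R\<^sup>2 = S \<epsilon>\<^sup>n\<^sup>+\<^sup>1\<close> gives \<open>O(sqrt (S / \<epsilon>\<^sup>n\<^sup>-\<^sup>1))\<close> half-spaces for a body of surface area \<open>S\<close>.

  The shell has volume \<open>O(\<epsilon>S)\<close>: if \<open>w\<close> is the minimal width, then \<open>K\<close> contains a ball of radius
  of order \<open>w\<close>, so the shell has volume \<open>O(\<epsilon>/w)\<close> times that of \<open>K\<close>; and sweeping a cover of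
  the boundary along the direction of minimal width bounds the volume of \<open>K\<close> by \<open>O(wS)\<close>.
\<close>

section \<open>Packings\<close>

text \<open>A family of greatest cardinality works: an \<open>x\<close> unrelated to all its members
  could be added to it. Reflexivity ensures that such an \<open>x\<close> is not already a
  member.\<close>

lemma finite_maximal_selection:
  assumes refl: "\<And>x. x \<in> X \<Longrightarrow> R x x"
    and bound: "\<And>F. \<lbrakk>finite F; F \<subseteq> X; pairwise (\<lambda>x y. \<not> R x y \<and> \<not> R y x) F\<rbrakk> \<Longrightarrow> real (card F) \<le> N"
  obtains F where "finite F" "F \<subseteq> X" "real (card F) \<le> N" "\<And>x. x \<in> X \<Longrightarrow> \<exists>y\<in>F. R x y \<or> R y x"
proof -
  define Q where "Q F \<longleftrightarrow> finite F \<and> F \<subseteq> X \<and> pairwise (\<lambda>x y. \<not> R x y \<and> \<not> R y x) F" for F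
  have Q0: "Q {}" by (simp add: Q_def)
  have "\<forall>F. Q F \<longrightarrow> card F < Suc (nat \<lfloor>N\<rfloor>)"
  proof (intro allI impI)
    fix F assume "Q F"
    then have "real (card F) \<le> N" using bound by (auto simp: Q_def)
    then show "card F < Suc (nat \<lfloor>N\<rfloor>)" by linarith
  qed
  then obtain F where F: "Q F" and max: "\<And>G. Q G \<Longrightarrow> card G \<le> card F"
    using ex_has_greatest_nat[of Q "{}" card "Suc (nat \<lfloor>N\<rfloor>)"] Q0 by (metis less_imp_le_nat)
  have "\<exists>y\<in>F. R x y \<or> R y x" if "x \<in> X" for x
  proof (rule ccontr)
    assume neg: "\<not> ?thesis"
    then have "x \<notin> F" using refl[OF that] by blast
    moreover have "Q (insert x F)"
      using F neg that by (auto simp: Q_def pairwise_insert)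
    ultimately show False
      using max[of "insert x F"] F by (simp add: Q_def)
  qed
  then show ?thesis
    using that[of F] F bound by (auto simp: Q_def)
qed

lemma card_packing_le:
  fixes A :: "'i \<Rightarrow> 'a::euclidean_space set"
  assumes "finite I" and A: "\<And>i. i \<in> I \<Longrightarrow> A i \<in> lmeasurable" "\<And>i. i \<in> I \<Longrightarrow> A i \<subseteq> T"
    and T: "T \<in> lmeasurable" and disj: "pairwise (\<lambda>i j. disjnt (A i) (A j)) I"
    and m: "\<And>i. i \<in> I \<Longrightarrow> m \<le> measure lebesgue (A i)"
  shows "real (card I) * m \<le> measure lebesgue T"
proof -
  have "real (card I) * m \<le> (\<Sum>i\<in>I. measure lebesgue (A i))"
    using sum_mono[OF m] by simp
  also have "\<dots> = measure lebesgue (\<Union>i\<in>I. A i)"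
    using measure_UNION'[OF \<open>finite I\<close> A(1) disj] by simp
  also have "\<dots> \<le> measure lebesgue T"
    by (intro measure_mono_fmeasurable sets.finite_UN) (use assms in auto)
  finally show ?thesis .
qed

section \<open>Boxes inscribed in and circumscribed about convex bodies\<close>

text \<open>By symmetry of \<open>D\<close> the signs move from the coefficients to the points. The
  normalised absolute values then give a convex combination, which is finally shrunk towards 0 by
  the factor \<open>s\<close>.\<close>

lemma absolutely_convex_sum:
  fixes x :: "'i \<Rightarrow> 'a::real_vector"
  assumes "convex D" and sym: "\<And>y. y \<in> D \<Longrightarrow> - y \<in> D" and "0 \<in> D" "finite I"
    and x: "\<And>i. i \<in> I \<Longrightarrow> x i \<in> D" and c: "(\<Sum>i\<in>I. \<bar>c i\<bar>) \<le> 1"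
  shows "(\<Sum>i\<in>I. c i *\<^sub>R x i) \<in> D"
proof (cases "(\<Sum>i\<in>I. \<bar>c i\<bar>) = 0")
  case True
  then have "\<forall>i\<in>I. c i = 0" using \<open>finite I\<close> by (simp add: sum_nonneg_eq_0_iff)
  then show ?thesis using \<open>0 \<in> D\<close> by simp
next
  case False
  define s where "s = (\<Sum>i\<in>I. \<bar>c i\<bar>)"
  have s: "s > 0" "s \<le> 1" using False c sum_nonneg[of I "\<lambda>i. \<bar>c i\<bar>"] unfolding s_def by (linarith | simp)+
  have "(\<Sum>i\<in>I. (\<bar>c i\<bar> / s) *\<^sub>R (sgn (c i) *\<^sub>R x i + (if c i = 0 then x i else 0))) \<in> D"
  proof (rule convex_sum[OF \<open>finite I\<close> \<open>convex D\<close>])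
    show "(\<Sum>i\<in>I. \<bar>c i\<bar> / s) = 1" using s by (simp add: s_def flip: sum_divide_distrib)
  qed (use s x sym in \<open>auto simp: sgn_if\<close>)
  also have "(\<Sum>i\<in>I. (\<bar>c i\<bar> / s) *\<^sub>R (sgn (c i) *\<^sub>R x i + (if c i = 0 then x i else 0)))
      = (1/s) *\<^sub>R (\<Sum>i\<in>I. c i *\<^sub>R x i)"
    unfolding scaleR_sum_right
    by (rule sum.cong) (auto simp: abs_mult_sgn scaleR_right_distrib)
  finally have "(1 - s) *\<^sub>R 0 + s *\<^sub>R ((1/s) *\<^sub>R (\<Sum>i\<in>I. c i *\<^sub>R x i)) \<in> D"
    using s \<open>0 \<in> D\<close> by (intro convexD[OF \<open>convex D\<close>]) auto
  then show ?thesis using s by simp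
qed

section \<open>Orthonormal frames and the boxes they span\<close>

definition orthonormal_frame :: "('a::euclidean_space \<Rightarrow> 'a) \<Rightarrow> bool" where
  "orthonormal_frame b \<longleftrightarrow> (\<forall>i\<in>Basis. \<forall>j\<in>Basis. b i \<bullet> b j = (if i = j then 1 else 0))"

definition frame_box :: "('a::euclidean_space \<Rightarrow> 'a) \<Rightarrow> ('a \<Rightarrow> real) \<Rightarrow> 'a set" where
  "frame_box b r = {z. \<forall>i\<in>Basis. \<bar>z \<bullet> b i\<bar> \<le> r i}"

lemma orthonormal_frame_expand:
  fixes z :: "'a::euclidean_space"
  assumes "orthonormal_frame b"
  shows "(\<Sum>i\<in>Basis. (z \<bullet> b i) *\<^sub>R b i) = z"
proof -
  have inj: "inj_on b Basis"
    using assms by (intro inj_onI) (metis (full_types) orthonormal_frame_def zero_neq_one)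
  have n1: "norm v = 1" if "v \<in> b ` Basis" for v
    using that assms by (auto simp: orthonormal_frame_def norm_eq_1)
  have orth: "pairwise orthogonal (b ` Basis)"
    using assms by (auto simp: pairwise_def orthogonal_def orthonormal_frame_def)
  have "independent (b ` Basis)"
    using orth n1 by (intro pairwise_orthogonal_independent) force+
  then have "span (b ` Basis) = UNIV"
    using card_ge_dim_independent[of "b ` Basis" UNIV] card_image[OF inj] by auto
  then have "(\<Sum>v\<in>b ` Basis. (z \<bullet> v) *\<^sub>R v) = z"
    using orth n1 by (intro orthonormal_basis_expand) auto
  then show ?thesis
    by (simp add: sum.reindex[OF inj] inner_commute)
qed

lemma orthonormal_frame_inner:
  fixes y z :: "'a::euclidean_space"
  assumes "orthonormal_frame b"
  shows "y \<bullet> z = (\<Sum>i\<in>Basis. (y \<bullet> b i) * (z \<bullet> b i))"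
proof -
  have "y \<bullet> z = (\<Sum>i\<in>Basis. (y \<bullet> b i) *\<^sub>R b i) \<bullet> z"
    by (simp only: orthonormal_frame_expand[OF assms])
  also have "\<dots> = (\<Sum>i\<in>Basis. (y \<bullet> b i) * (z \<bullet> b i))"
    by (simp add: inner_sum_left inner_commute[of z])
  finally show ?thesis .
qed

lemma norm_le_orthonormal_frame:
  fixes z :: "'a::euclidean_space"
  assumes "orthonormal_frame b"
  shows "norm z \<le> (\<Sum>i\<in>Basis. \<bar>z \<bullet> b i\<bar>)"
proof -
  have "norm z = norm (\<Sum>i\<in>Basis. (z \<bullet> b i) *\<^sub>R b i)"
    by (simp only: orthonormal_frame_expand[OF assms])
  also have "\<dots> \<le> (\<Sum>i\<in>Basis. norm ((z \<bullet> b i) *\<^sub>R b i))" by (rule norm_sum)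
  also have "\<dots> = (\<Sum>i\<in>Basis. \<bar>z \<bullet> b i\<bar>)"
    using assms by (intro sum.cong) (auto simp: orthonormal_frame_def norm_eq_sqrt_inner)
  finally show ?thesis .
qed

lemma compact_frame_box:
  assumes "orthonormal_frame b"
  shows "compact (frame_box b r)"
  unfolding compact_eq_bounded_closed
proof
  have "norm z \<le> (\<Sum>i\<in>Basis. r i)" if "z \<in> frame_box b r" for z
    using norm_le_orthonormal_frame[OF assms, of z] that
    by (smt (verit, best) frame_box_def mem_Collect_eq sum_mono)
  then show "bounded (frame_box b r)" by (auto simp: bounded_iff)
  have "closed (\<Inter>i\<in>Basis. {z. \<bar>z \<bullet> b i\<bar> \<le> r i})"
    by (intro closed_INT closed_Collect_le ballI continuous_intros)
  also have "(\<Inter>i\<in>Basis. {z. \<bar>z \<bullet> b i\<bar> \<le> r i}) = frame_box b r"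
    by (auto simp: frame_box_def)
  finally show "closed (frame_box b r)" .
qed

text \<open>The packings need the volume only up to a constant factor. So disjoint balls of radius
  \<open>h/2\<close> are placed in the box on a rotated grid of mesh \<open>h\<close>, the smallest
  half-length.\<close>

lemma measure_frame_box_ge:
  fixes b :: "'a::euclidean_space \<Rightarrow> 'a"
  assumes b: "orthonormal_frame b" and r: "\<And>i. i \<in> Basis \<Longrightarrow> r i > 0"
  shows "unit_ball_vol (real DIM('a)) / 4 ^ DIM('a) * (\<Prod>i\<in>Basis. r i)
           \<le> measure lebesgue (frame_box b r)"
proof -
  define h where "h = Min (r ` Basis)"
  have h: "h > 0" "\<And>i. i \<in> Basis \<Longrightarrow> h \<le> r i"
    using r by (auto simp: h_def)
  \<comment> \<open>As \<open>r i / h\<close> is at least 1, rounding it down loses at most a factor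
    2. Together with the radius \<open>h/2\<close> this produces the factor 4 per dimension.\<close>
  define k where "k i = nat \<lfloor>r i / h\<rfloor>" for i
  have k: "real (k i) * h \<le> r i" "r i / (2 * h) \<le> real (k i)" if "i \<in> Basis" for i
  proof -
    have "1 \<le> r i / h" using h that by simp
    then have 1: "real (k i) \<le> r i / h" "r i / h < real (k i) + 1" "1 \<le> real (k i)"
      unfolding k_def by (linarith, linarith, simp add: le_nat_iff)
    from 1(1) show "real (k i) * h \<le> r i" using h by (simp add: pos_le_divide_eq)
    have "r i / h \<le> 2 * real (k i)" using 1 by linarith
    then show "r i / (2 * h) \<le> real (k i)" using h by (simp add: field_simps)
  qed
  define I where "I = Pi\<^sub>E (Basis::'a set) (\<lambda>i. {..<k i})"
  define c where "c f = (\<Sum>i\<in>Basis. (h * real (f i)) *\<^sub>R b i)" for f :: "'a \<Rightarrow> nat"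
  have cb: "c f \<bullet> b i = h * real (f i)" if "i \<in> Basis" for f i
  proof -
    have "c f \<bullet> b i = (\<Sum>j\<in>Basis. (h * real (f j)) * (b j \<bullet> b i))"
      by (simp add: c_def inner_sum_left)
    also have "\<dots> = (\<Sum>j\<in>Basis. if j = i then h * real (f j) else 0)"
      using b that by (intro sum.cong) (auto simp: orthonormal_frame_def)
    finally show ?thesis using that by simp
  qed
  have nb: "\<bar>z \<bullet> b i\<bar> \<le> norm z" if "i \<in> Basis" for z i
    using Cauchy_Schwarz_ineq2[of z "b i"] b that
    by (auto simp: orthonormal_frame_def norm_eq_sqrt_inner)
  have "real (card I) * (unit_ball_vol (real DIM('a)) * (h/2) ^ DIM('a)) \<le> measure lebesgue (frame_box b r)"
  proof (rule card_packing_le)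
    show "finite I" by (auto simp: I_def intro!: finite_PiE)
    show "ball (c f) (h/2) \<in> lmeasurable" for f by simp
    show "frame_box b r \<in> lmeasurable"
      by (simp add: compact_frame_box[OF b] lmeasurable_compact)
    show "unit_ball_vol (real DIM('a)) * (h/2) ^ DIM('a) \<le> measure lebesgue (ball (c f) (h/2))" for f
      using h by (simp add: content_ball)
    show "ball (c f) (h/2) \<subseteq> frame_box b r" if "f \<in> I" for f
    proof
      fix z assume "z \<in> ball (c f) (h/2)"
      then have z: "norm (z - c f) < h/2" by (simp add: dist_norm norm_minus_commute)
      have "\<bar>z \<bullet> b i\<bar> \<le> r i" if i: "i \<in> Basis" for i
      proof -
        have "\<bar>(z - c f) \<bullet> b i\<bar> < h/2" using nb[OF i, of "z - c f"] z by linarith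
        then have 1: "\<bar>z \<bullet> b i - h * real (f i)\<bar> < h/2" by (simp add: inner_diff_left cb[OF i])
        have "real (f i) + 1 \<le> real (k i)" using \<open>f \<in> I\<close> i by (force simp: I_def)
        then have "h * (real (f i) + 1) \<le> h * real (k i)"
          using h by (intro mult_left_mono) auto
        also have "\<dots> \<le> r i" using k(1)[OF i] by (simp add: mult.commute)
        finally have "h * real (f i) + h \<le> r i" by (simp add: algebra_simps)
        moreover have "0 \<le> h * real (f i)" using h by simp
        ultimately show ?thesis using 1 h by linarith
      qed
      then show "z \<in> frame_box b r" by (simp add: frame_box_def)
    qed
    show "pairwise (\<lambda>f g. disjnt (ball (c f) (h/2)) (ball (c g) (h/2))) I"
    proof (intro pairwiseI)
      fix f g assume fg: "f \<in> I" "g \<in> I" "f \<noteq> g"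
      then obtain i where i: "i \<in> Basis" "f i \<noteq> g i"
        by (metis I_def PiE_ext)
      have "h * 1 \<le> h * \<bar>real (f i) - real (g i)\<bar>"
        using i h by (intro mult_left_mono) auto
      also have "\<dots> = \<bar>(c f - c g) \<bullet> b i\<bar>"
        using h by (simp add: inner_diff_left cb[OF i(1)] abs_mult flip: right_diff_distrib)
      also have "\<dots> \<le> norm (c f - c g)" by (rule nb[OF i(1)])
      finally show "disjnt (ball (c f) (h/2)) (ball (c g) (h/2))"
        by (intro disjoint_ballI[unfolded disjnt_def[symmetric]]) (auto simp: dist_norm disjnt_def)
    qed
  qed
  moreover have "real (card I) = (\<Prod>i\<in>(Basis::'a set). real (k i))"
    by (simp add: I_def card_PiE)
  moreover have "(\<Prod>i\<in>(Basis::'a set). r i / (2 * h)) \<le> (\<Prod>i\<in>(Basis::'a set). real (k i))"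
    using k h r by (intro prod_mono) (auto intro: less_imp_le)
  moreover have "(\<Prod>i\<in>(Basis::'a set). r i / (2 * h)) = (\<Prod>i\<in>(Basis::'a set). r i) / (2 * h) ^ DIM('a)"
    by (simp add: prod_dividef)
  ultimately have "(\<Prod>i\<in>(Basis::'a set). r i) / (2 * h) ^ DIM('a) * (unit_ball_vol (real DIM('a)) * (h/2) ^ DIM('a))
      \<le> measure lebesgue (frame_box b r)"
    by (smt (verit) h mult_right_mono unit_ball_vol_nonneg zero_le_power mult_nonneg_nonneg half_gt_zero of_nat_0_le_iff)
  moreover have "(\<Prod>i\<in>(Basis::'a set). r i) / (2 * h) ^ DIM('a) * (unit_ball_vol (real DIM('a)) * (h/2) ^ DIM('a))
     = unit_ball_vol (real DIM('a)) / 4 ^ DIM('a) * (\<Prod>i\<in>Basis. r i)"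
  proof -
    have "(4::real) ^ DIM('a) = 2 ^ DIM('a) * 2 ^ DIM('a)" by (simp flip: power_mult_distrib)
    then show ?thesis using h by (simp add: power_mult_distrib power_divide field_simps)
  qed
  ultimately show ?thesis by simp
qed

text \<open>Greedy Gram-Schmidt: the next vector is the residual of a point of \<open>D\<close> farthest from the span of
  the previous ones, so that its length bounds the whole of \<open>D\<close> in the new direction.\<close>

lemma greedy_orthonormal_vectors:
  fixes D :: "'a::euclidean_space set"
  assumes D: "compact D" "convex D" "interior D \<noteq> {}" and sym: "\<And>y. y \<in> D \<Longrightarrow> - y \<in> D"
    and "finite S" "S \<subseteq> (Basis :: 'a set)"
  shows "\<exists>b r. (\<forall>i\<in>S. \<forall>j\<in>S. b i \<bullet> b j = (if i = j then 1 else 0)) \<and>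
           (\<forall>i\<in>S. r i > 0 \<and> (\<forall>y\<in>D. \<bar>y \<bullet> b i\<bar> \<le> r i) \<and> (r i / fact (card S + 1)) *\<^sub>R b i \<in> D)"
  using \<open>finite S\<close> \<open>S \<subseteq> Basis\<close>
proof (induction S rule: finite_induct)
  case empty
  then show ?case by auto
next
  case (insert k S)
  obtain b r where b: "\<And>i j. i \<in> S \<Longrightarrow> j \<in> S \<Longrightarrow> b i \<bullet> b j = (if i = j then 1 else 0)"
    and r: "\<And>i. i \<in> S \<Longrightarrow> r i > 0" "\<And>i y. i \<in> S \<Longrightarrow> y \<in> D \<Longrightarrow> \<bar>y \<bullet> b i\<bar> \<le> r i"
      "\<And>i. i \<in> S \<Longrightarrow> (r i / fact (card S + 1)) *\<^sub>R b i \<in> D"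
  proof -
    obtain b r where "\<forall>i\<in>S. \<forall>j\<in>S. b i \<bullet> b j = (if i = j then 1 else 0)"
      "\<forall>i\<in>S. r i > 0 \<and> (\<forall>y\<in>D. \<bar>y \<bullet> b i\<bar> \<le> r i) \<and> (r i / fact (card S + 1)) *\<^sub>R b i \<in> D"
      using insert.IH insert.prems by blast
    then show thesis by (intro that[of b r]) blast+
  qed
  have "D \<noteq> {}" using D by auto
  then obtain y0 where "y0 \<in> D" by auto
  then have zero: "0 \<in> D"
    using convexD[OF \<open>convex D\<close> \<open>y0 \<in> D\<close> sym[OF \<open>y0 \<in> D\<close>], of "1/2" "1/2"] by simp
  define R where "R y = y - (\<Sum>j\<in>S. (y \<bullet> b j) *\<^sub>R b j)" for y :: 'a
  have "continuous_on D (\<lambda>y. norm (R y))" unfolding R_def by (intro continuous_intros)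
  then obtain y where y: "y \<in> D" "\<And>z. z \<in> D \<Longrightarrow> norm (R z) \<le> norm (R y)"
    using continuous_attains_sup[OF \<open>compact D\<close> \<open>D \<noteq> {}\<close>] by blast
  have Rb: "R z \<bullet> b j = 0" if "j \<in> S" for z j
  proof -
    have "(\<Sum>i\<in>S. (z \<bullet> b i) *\<^sub>R b i) \<bullet> b j = (\<Sum>i\<in>S. if i = j then z \<bullet> b i else 0)"
      unfolding inner_sum_left using b that by (intro sum.cong) auto
    then show ?thesis using that insert.hyps by (simp add: R_def inner_diff_left)
  qed
  define \<rho> where "\<rho> = norm (R y)"
  \<comment> \<open>Otherwise \<open>D\<close> would lie in the span of fewer than
    \<open>DIM('a)\<close> vectors and have empty interior.\<close>
  have "\<rho> > 0"
  proof (rule ccontr)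
    assume "\<not> \<rho> > 0"
    then have "R z = 0" if "z \<in> D" for z using y(2)[OF that] by (simp add: \<rho>_def)
    then have "D \<subseteq> span (b ` S)"
      unfolding R_def by (metis (no_types, lifting) eq_iff_diff_eq_0 image_eqI span_base span_scale span_sum subsetI)
    then have "dim D \<le> card (b ` S)"
      using insert.hyps by (intro dim_le_card) auto
    also have "\<dots> \<le> card S" using insert.hyps by (intro card_image_le)
    also have "\<dots> < DIM('a)"
      using insert.hyps insert.prems by (intro psubset_card_mono[OF finite_Basis]) auto
    finally show False using empty_interior_lowdim D(3) by blast
  qed
  define v where "v = (1/\<rho>) *\<^sub>R R y"
  have v1: "v \<bullet> v = 1" using \<open>\<rho> > 0\<close> by (simp add: v_def \<rho>_def norm_eq_sqrt_inner flip: power2_eq_square)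
     
  have vb: "v \<bullet> b j = 0" if "j \<in> S" for j using Rb[OF that] by (simp add: v_def)
  have vbound: "\<bar>z \<bullet> v\<bar> \<le> \<rho>" if "z \<in> D" for z
  proof -
    have "z \<bullet> v = R z \<bullet> v"
    proof -
      have "(\<Sum>j\<in>S. (z \<bullet> b j) *\<^sub>R b j) \<bullet> v = (\<Sum>j\<in>S. 0)"
        unfolding inner_sum_left using vb by (intro sum.cong) (auto simp: inner_commute)
      then show ?thesis by (simp add: R_def inner_diff_left)
    qed
    also have "\<bar>\<dots>\<bar> \<le> norm (R z) * norm v" by (rule Cauchy_Schwarz_ineq2)
    also have "\<dots> = norm (R z)" using v1 by (simp add: norm_eq_sqrt_inner)
    finally show ?thesis using y(2)[OF that] by (simp add: \<rho>_def)
  qed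
  let ?F = "fact (card S + 1) :: real" and ?G = "fact (card S + 2) :: real"
  have G: "?G = (real (card S) + 2) * ?F" by (simp add: algebra_simps)
  have F1: "?F \<ge> 1" by (rule fact_ge_1)
  have vD: "(\<rho> / ?G) *\<^sub>R v \<in> D"
  proof -
    \<comment> \<open>\<open>R y\<close> divided by \<open>?G\<close> is an absolutely convex
      combination of points of \<open>D\<close>: it is \<open>y\<close> minus its components along
      the earlier vectors, and each component is a multiple of the known point along
      \<open>b i\<close>, with a factor controlled by the bound \<open>r i\<close> on
      \<open>D\<close>. The absolute weights sum to at most \<open>(1 + card S * ?F) / ?G\<close>,
      which the factorial keeps below 1.\<close>
    define x where "x i = (if i = k then y else (r i / ?F) *\<^sub>R b i)" for i
    define c where "c i = (if i = k then 1 / ?G else - (y \<bullet> b i) / r i * (?F / ?G))" for i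
    have "(\<Sum>i\<in>insert k S. c i *\<^sub>R x i) \<in> D"
    proof (rule absolutely_convex_sum[OF \<open>convex D\<close> sym zero])
      show "x i \<in> D" if "i \<in> insert k S" for i using that y r insert.hyps by (auto simp: x_def)
      have "\<bar>c i\<bar> \<le> ?F / ?G" if "i \<in> S" for i
      proof -
        have "\<bar>y \<bullet> b i\<bar> / r i \<le> 1" using r that y by (simp add: divide_le_eq)
        then have "\<bar>y \<bullet> b i\<bar> / r i * (?F / ?G) \<le> 1 * (?F / ?G)" by (intro mult_right_mono) auto
        then show ?thesis using that insert.hyps r[OF that]
          by (auto simp: c_def abs_mult abs_divide)
      qed
      then have "(\<Sum>i\<in>S. \<bar>c i\<bar>) \<le> (\<Sum>i\<in>S. ?F / ?G)" by (intro sum_mono) auto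
      then have "(\<Sum>i\<in>insert k S. \<bar>c i\<bar>) \<le> 1 / ?G + real (card S) * (?F / ?G)"
        using insert.hyps by (simp add: c_def)
      also have "\<dots> = (1 + real (card S) * ?F) / ?G" by (simp add: add_divide_distrib)
      also have "\<dots> \<le> 1"
      proof -
        have "1 + m * F \<le> (m + 2) * F" if "F \<ge> 1" for m F :: real
          using that by (simp add: algebra_simps)
        from this[OF F1, of "real (card S)"] show ?thesis
          unfolding G[symmetric] by (intro divide_le_eq_1_pos[THEN iffD2] fact_gt_zero)
      qed
      finally show "(\<Sum>i\<in>insert k S. \<bar>c i\<bar>) \<le> 1" .
    qed (use insert.hyps in auto)
    also have "(\<Sum>i\<in>insert k S. c i *\<^sub>R x i) = (1/?G) *\<^sub>R y + (\<Sum>i\<in>S. c i *\<^sub>R x i)"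
      using insert.hyps by (simp add: c_def x_def)
    also have "(\<Sum>i\<in>S. c i *\<^sub>R x i) = (\<Sum>i\<in>S. - ((1/?G) *\<^sub>R (y \<bullet> b i) *\<^sub>R b i))"
    proof (intro sum.cong refl)
      fix i assume "i \<in> S"
      then have "i \<noteq> k" "r i > 0" using insert.hyps r by auto
      then show "c i *\<^sub>R x i = - ((1/?G) *\<^sub>R (y \<bullet> b i) *\<^sub>R b i)"
        using F1 by (simp add: c_def x_def)
    qed
    also have "(1/?G) *\<^sub>R y + (\<Sum>i\<in>S. - ((1/?G) *\<^sub>R (y \<bullet> b i) *\<^sub>R b i)) = (1/?G) *\<^sub>R R y"
      by (simp add: R_def scaleR_diff_right scaleR_sum_right sum_negf)
    also have "\<dots> = (\<rho> / ?G) *\<^sub>R v" using \<open>\<rho> > 0\<close> by (simp add: v_def)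
    finally show ?thesis .
  qed
  \<comment> \<open>The denominator of the invariant grows with the number of vectors, so the old
    points are moved towards 0 to match it.\<close>
  have shrink: "(r i / ?G) *\<^sub>R b i \<in> D" if "i \<in> S" for i
  proof -
    have "(1 - ?F/?G) *\<^sub>R 0 + (?F/?G) *\<^sub>R ((r i / ?F) *\<^sub>R b i) \<in> D"
      using r(3)[OF that] zero F1
      by (intro convexD[OF \<open>convex D\<close>]) (auto simp: G divide_le_eq_1)
    then show ?thesis using F1 by simp
  qed
  let ?b = "b(k := v)" and ?r = "r(k := \<rho>)"
  have "?b i \<bullet> ?b j = (if i = j then 1 else 0)" if "i \<in> insert k S" "j \<in> insert k S" for i j
    using that insert.hyps b v1 vb by (cases "i = k"; cases "j = k") (auto simp: inner_commute)
  moreover have "?r i > 0 \<and> (\<forall>y\<in>D. \<bar>y \<bullet> ?b i\<bar> \<le> ?r i) \<and> (?r i / fact (card (insert k S) + 1)) *\<^sub>R ?b i \<in> D"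
    if "i \<in> insert k S" for i
  proof -
    have "card (insert k S) + 1 = card S + 2" using insert.hyps by simp
    then show ?thesis
      using that insert.hyps r vbound vD shrink \<open>\<rho> > 0\<close> by (cases "i = k") (auto simp del: fact_Suc)
  qed
  ultimately show ?case by blast
qed

text \<open>Proportion between the inner and the outer box of a convex body: the factorial comes
  from the greedy vectors, \<open>n\<close> from averaging over all directions, and 2 from measuring
  a segment from its midpoint.\<close>

definition box_ratio :: "nat \<Rightarrow> real" where
  "box_ratio n = 1 / (2 * real n * fact (n + 1))"

text \<open>The greedy frame is taken for the difference body \<open>D\<close>, which contains
  \<open>A\<close> because 0 lies in \<open>A\<close>. Its points along \<open>b i\<close> are
  differences of points of \<open>A\<close>, so \<open>A\<close> contains a segment of length
  \<open>r i / ?F\<close> in direction \<open>b i\<close>. The average of these segments over the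
  frame is a parallel box inside \<open>A\<close>, centred at \<open>g\<close>.\<close>

lemma convex_body_frame_box:
  fixes A :: "'a::euclidean_space set"
  assumes A: "compact A" "convex A" "0 \<in> A" "interior A \<noteq> {}"
  obtains b r g where "orthonormal_frame b" "\<And>i. i \<in> Basis \<Longrightarrow> r i > 0" "A \<subseteq> frame_box b r" "g \<in> A"
    "\<And>z. z \<in> frame_box b (\<lambda>i. box_ratio DIM('a) * r i) \<Longrightarrow> g + z \<in> A"
proof -
  let ?n = "DIM('a)"
  let ?F = "fact (?n + 1) :: real"
  define D where "D = {x - y | x y. x \<in> A \<and> y \<in> A}"
  have "A \<subseteq> D" using A(3) unfolding D_def by force
  then have "interior D \<noteq> {}" using interior_mono A(4) by blast
  have "compact D" unfolding D_def using compact_differences[OF A(1) A(1)] by simp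
  have "convex D" 
  proof -
    have "D = (\<Union>x\<in>A. \<Union>y\<in>A. {x - y})" by (auto simp: D_def)
    then show ?thesis using convex_differences[OF A(2) A(2)] by simp
  qed
  have sym: "- y \<in> D" if "y \<in> D" for y using that unfolding D_def by force
  obtain b :: "'a \<Rightarrow> 'a" and r where br: "\<forall>i\<in>Basis. \<forall>j\<in>Basis. b i \<bullet> b j = (if i = j then 1 else 0)"
     "\<forall>i\<in>Basis. r i > 0 \<and> (\<forall>y\<in>D. \<bar>y \<bullet> b i\<bar> \<le> r i) \<and> (r i / fact (card (Basis::'a set) + 1)) *\<^sub>R b i \<in> D"
    using greedy_orthonormal_vectors[OF \<open>compact D\<close> \<open>convex D\<close> \<open>interior D \<noteq> {}\<close> _ finite_Basis subset_refl] sym by blast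
  have fr: "orthonormal_frame b" using br(1) by (simp add: orthonormal_frame_def)
  have rpos: "r i > 0" if "i \<in> Basis" for i using br(2) that by auto
  have "\<forall>i\<in>Basis. \<exists>x y. (r i / ?F) *\<^sub>R b i = x - y \<and> x \<in> A \<and> y \<in> A"
    using br(2) unfolding D_def by blast
  then obtain p q where pq: "\<And>i. i \<in> Basis \<Longrightarrow> (r i / ?F) *\<^sub>R b i = p i - q i"
      "\<And>i. i \<in> Basis \<Longrightarrow> p i \<in> A" "\<And>i. i \<in> Basis \<Longrightarrow> q i \<in> A"
    by metis
  define g where "g = (\<Sum>i\<in>Basis. (1 / real ?n) *\<^sub>R ((1/2) *\<^sub>R p i + (1/2) *\<^sub>R q i))"
  have box: "g + z \<in> A" if z: "z \<in> frame_box b (\<lambda>i. box_ratio ?n * r i)" for z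
  proof -
    \<comment> \<open>\<open>t i\<close> is the position relative to the midpoint of the segment
      from \<open>q i\<close> to \<open>p i\<close> at which the average is displaced by the
      component of \<open>z\<close> along \<open>b i\<close>.\<close>
    define t where "t i = real ?n * (z \<bullet> b i) * ?F / r i" for i
    have t: "\<bar>t i\<bar> \<le> 1/2" if i: "i \<in> Basis" for i
    proof -
      have "\<bar>z \<bullet> b i\<bar> \<le> r i / (2 * real ?n * ?F)"
        using z i by (auto simp: frame_box_def box_ratio_def)
      then have "\<bar>z \<bullet> b i\<bar> * (real ?n * ?F) \<le> r i / (2 * real ?n * ?F) * (real ?n * ?F)"
        by (intro mult_right_mono) auto
      also have "\<dots> = r i / 2" by simp
      finally show ?thesis using rpos[OF i] by (simp add: t_def abs_mult divide_le_eq mult_ac del: fact_Suc)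
    qed
    have "(\<Sum>i\<in>(Basis::'a set). (1 / real ?n) *\<^sub>R ((1/2 + t i) *\<^sub>R p i + (1/2 - t i) *\<^sub>R q i)) \<in> A"
    proof (rule convex_sum[OF finite_Basis A(2)])
      show "(1/2 + t i) *\<^sub>R p i + (1/2 - t i) *\<^sub>R q i \<in> A" if "i \<in> Basis" for i
        using t[OF that] pq[OF that] by (intro convexD[OF A(2)]) (auto simp: abs_le_iff)
    qed auto
    also have "(\<Sum>i\<in>(Basis::'a set). (1 / real ?n) *\<^sub>R ((1/2 + t i) *\<^sub>R p i + (1/2 - t i) *\<^sub>R q i))
      = (\<Sum>i\<in>Basis. (1 / real ?n) *\<^sub>R ((1/2) *\<^sub>R p i + (1/2) *\<^sub>R q i) + (z \<bullet> b i) *\<^sub>R b i)"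
    proof (intro sum.cong refl)
      fix i :: 'a assume i: "i \<in> Basis"
      have "(1 / real ?n) *\<^sub>R ((1/2 + t i) *\<^sub>R p i + (1/2 - t i) *\<^sub>R q i)
        = (1 / real ?n) *\<^sub>R ((1/2) *\<^sub>R p i + (1/2) *\<^sub>R q i) + (t i / real ?n) *\<^sub>R (p i - q i)"
        by (simp add: algebra_simps)
      also have "(t i / real ?n) *\<^sub>R (p i - q i) = (z \<bullet> b i) *\<^sub>R b i"
        unfolding pq(1)[OF i, symmetric] using rpos[OF i] by (simp add: t_def)
      finally show "(1 / real ?n) *\<^sub>R ((1/2 + t i) *\<^sub>R p i + (1/2 - t i) *\<^sub>R q i)
        = (1 / real ?n) *\<^sub>R ((1/2) *\<^sub>R p i + (1/2) *\<^sub>R q i) + (z \<bullet> b i) *\<^sub>R b i" .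
    qed
    also have "\<dots> = g + z"
      by (simp only: sum.distrib orthonormal_frame_expand[OF fr] g_def)
    finally show ?thesis .
  qed
  have "0 \<in> frame_box b (\<lambda>i. box_ratio ?n * r i)"
    using rpos by (auto simp: frame_box_def box_ratio_def intro!: less_imp_le)
  then have "g \<in> A" using box[of 0] by simp
  moreover have "A \<subseteq> frame_box b r" using \<open>A \<subseteq> D\<close> br(2) by (auto simp: frame_box_def)
  ultimately show ?thesis using that fr rpos box by blast
qed

lemma box_ratio_pos: "n > 0 \<Longrightarrow> box_ratio n > 0"
  by (simp add: box_ratio_def)

lemma uminus_frame_box: "- z \<in> frame_box b r \<longleftrightarrow> z \<in> frame_box b r"
  by (simp add: frame_box_def)

lemma scale_frame_box: "z \<in> frame_box b r \<Longrightarrow> c \<ge> 0 \<Longrightarrow> c *\<^sub>R z \<in> frame_box b (\<lambda>i. c * r i)"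
  by (auto simp: frame_box_def abs_mult intro: mult_left_mono)

section \<open>Macbeath regions\<close>

text \<open>This is the Macbeath region of \<open>L\<close> at \<open>x\<close>, the intersection of
  \<open>L\<close> with its reflection in \<open>x\<close>, translated so that \<open>x\<close>
  becomes the origin.\<close>

definition symmetric_part :: "'a::real_vector set \<Rightarrow> 'a \<Rightarrow> 'a set" where
  "symmetric_part L x = {v. x + v \<in> L \<and> x - v \<in> L}"

text \<open>By \<open>eq\<close> the point in question is \<open>y + c/5\<close>, so a region at
  \<open>y\<close> scaled by 1/5 that meets the one at \<open>x\<close> lies in the full region at
  \<open>x\<close>. The point is on the segment from \<open>y\<close> to \<open>y + c\<close>. Its
  reflection in \<open>x\<close> is the convex combination of \<open>x - a\<close>,
  \<open>x\<close>, \<open>y + b\<close>, \<open>y - c\<close> with weights 3/10, 2/10, 3/10,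
  2/10.\<close>

lemma macbeath_expansion:
  assumes "convex L" and a: "a \<in> symmetric_part L x" and b: "b \<in> symmetric_part L y"
    and c: "c \<in> symmetric_part L y" and eq: "x + a /\<^sub>R 5 = y + b /\<^sub>R 5"
  shows "(a - b + c) /\<^sub>R 5 \<in> symmetric_part L x"
proof -
  have L: "x + a \<in> L" "x - a \<in> L" "y + b \<in> L" "y - c \<in> L" "y + c \<in> L" "y - b \<in> L"
    using a b c by (auto simp: symmetric_part_def)
  have y: "y = x + (a - b) /\<^sub>R 5"
    using eq by (simp add: algebra_simps)
  have x: "x \<in> L"
    using convexD[OF \<open>convex L\<close> L(1,2), of "1/2" "1/2"] by (simp add: algebra_simps flip: scaleR_add_left)
  have yL: "y \<in> L"
    using convexD[OF \<open>convex L\<close> L(3,6), of "1/2" "1/2"] by (simp add: algebra_simps flip: scaleR_add_left)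
  have "(4/5) *\<^sub>R y + (1/5) *\<^sub>R (y + c) \<in> L"
    by (rule convexD[OF \<open>convex L\<close> yL L(5)]) auto
  also have "(4/5) *\<^sub>R y + (1/5) *\<^sub>R (y + c) = x + (a - b + c) /\<^sub>R 5"
    by (simp add: y algebra_simps flip: scaleR_add_left)
  finally have 1: "x + (a - b + c) /\<^sub>R 5 \<in> L" .
  have m1: "(3/5) *\<^sub>R (x - a) + (2/5) *\<^sub>R x \<in> L"
    by (rule convexD[OF \<open>convex L\<close> L(2) x]) auto
  have m2: "(3/5) *\<^sub>R (y + b) + (2/5) *\<^sub>R (y - c) \<in> L"
    by (rule convexD[OF \<open>convex L\<close> L(3,4)]) auto
  have "(1/2) *\<^sub>R ((3/5) *\<^sub>R (x - a) + (2/5) *\<^sub>R x) + (1/2) *\<^sub>R ((3/5) *\<^sub>R (y + b) + (2/5) *\<^sub>R (y - c)) \<in> L"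
    by (rule convexD[OF \<open>convex L\<close> m1 m2]) auto
  also have "(1/2) *\<^sub>R ((3/5) *\<^sub>R (x - a) + (2/5) *\<^sub>R x) + (1/2) *\<^sub>R ((3/5) *\<^sub>R (y + b) + (2/5) *\<^sub>R (y - c))
      = x - (a - b + c) /\<^sub>R 5"
  proof -
    have e: "(1/2) *\<^sub>R z + ((1/2) *\<^sub>R z + t) = z + t"
      "(1/5) *\<^sub>R z + ((1/10) *\<^sub>R z + t) = (3/10) *\<^sub>R z + t"
      "(1/5) *\<^sub>R z + (1/10) *\<^sub>R z = (3/10) *\<^sub>R z" for z t :: 'a
      by (simp_all flip: scaleR_add_left add.assoc)
    show ?thesis
      by (simp add: y algebra_simps e flip: scaleR_add_left scaleR_left_diff_distrib)
  qed
  finally show ?thesis using 1 by (simp add: symmetric_part_def)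
qed

lemma symmetric_part_scale:
  assumes "convex L" "w \<in> symmetric_part L x"
  shows "(1/5) *\<^sub>R w \<in> symmetric_part L x" "0 \<in> symmetric_part L x"
proof -
  have L: "x + w \<in> L" "x - w \<in> L" using assms by (auto simp: symmetric_part_def)
  have "(1/2) *\<^sub>R (x + w) + (1/2) *\<^sub>R (x - w) \<in> L" by (rule convexD[OF \<open>convex L\<close> L]) auto
  then have x: "x \<in> L" by (simp add: algebra_simps flip: scaleR_add_left)
  then show "0 \<in> symmetric_part L x" by (simp add: symmetric_part_def)
  have "(4/5) *\<^sub>R x + (1/5) *\<^sub>R (x + w) \<in> L" "(4/5) *\<^sub>R x + (1/5) *\<^sub>R (x - w) \<in> L"
    by (rule convexD[OF \<open>convex L\<close> x L(1)] convexD[OF \<open>convex L\<close> x L(2)]; simp)+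
  then show "(1/5) *\<^sub>R w \<in> symmetric_part L x"
    by (simp add: symmetric_part_def algebra_simps flip: scaleR_add_left)
qed

section \<open>Volumes of shells and slabs\<close>

lemma power_diff_le:
  fixes x y :: real
  assumes "0 \<le> y" "y \<le> x"
  shows "x ^ n - y ^ n \<le> real n * (x - y) * x ^ (n - 1)"
proof -
  have "x ^ n - y ^ n = (x - y) * (\<Sum>i<n. y ^ (n - Suc i) * x ^ i)"
    by (rule power_diff_sumr2)
  also have "\<dots> \<le> (x - y) * (\<Sum>i<n. x ^ (n - 1))"
  proof (intro mult_left_mono sum_mono)
    fix i assume "i \<in> {..<n}"
    have "y ^ (n - Suc i) * x ^ i \<le> x ^ (n - Suc i) * x ^ i"
      using assms by (intro mult_right_mono power_mono) auto
    also have "\<dots> = x ^ (n - 1)" using \<open>i \<in> {..<n}\<close> by (simp flip: power_add)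
    finally show "y ^ (n - Suc i) * x ^ i \<le> x ^ (n - 1)" .
  qed (use assms in auto)
  finally show ?thesis by (simp add: algebra_simps)
qed

lemma measure_homothety:
  fixes K :: "'a::euclidean_space set"
  shows "measure lebesgue ((\<lambda>x. a + c *\<^sub>R (x - a)) ` K) = \<bar>c\<bar> ^ DIM('a) * measure lebesgue K"
proof -
  have eq: "(\<lambda>x. a + c *\<^sub>R (x - a)) = (\<lambda>x. c *\<^sub>R x + (a - c *\<^sub>R a))" by (auto simp: algebra_simps)
  show ?thesis unfolding eq by (rule measure_lebesgue_affine)
qed

lemma compact_homothety:
  fixes K :: "'a::euclidean_space set"
  shows "compact K \<Longrightarrow> compact ((\<lambda>x. a + c *\<^sub>R (x - a)) ` K)"
  by (intro compact_continuous_image continuous_intros)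

text \<open>For \<eta> > 0, the point \<open>z = a + y / \<eta>\<close> lies in the inscribed ball,
  and \<open>x + y\<close> is the image of the convex combination of \<open>x\<close> and
  \<open>z\<close> with weights \<open>1/(1+\<eta>)\<close> and
  \<open>\<eta>/(1+\<eta>)\<close>.\<close>

lemma offset_subset_homothety:
  fixes K :: "'a::euclidean_space set"
  assumes "convex K" "cball a r \<subseteq> K" "r > 0" "x \<in> K" "norm y \<le> \<eta> * r" "0 \<le> \<eta>"
  shows "x + y \<in> (\<lambda>x. a + (1 + \<eta>) *\<^sub>R (x - a)) ` K"
proof (cases "\<eta> = 0")
  case True
  then show ?thesis using assms by (auto simp: image_iff)
next
  case False
  then have \<eta>: "\<eta> > 0" using assms by simp
  define z where "z = a + (1/\<eta>) *\<^sub>R y"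
  have "norm ((1/\<eta>) *\<^sub>R y) \<le> r" using assms \<eta> by (simp add: divide_le_eq mult.commute)
  then have "z \<in> K" using assms(2) by (auto simp: z_def dist_norm)
  then have "(1/(1+\<eta>)) *\<^sub>R x + (\<eta>/(1+\<eta>)) *\<^sub>R z \<in> K"
    using \<eta> \<open>x \<in> K\<close> by (intro convexD[OF \<open>convex K\<close>]) (auto simp flip: add_divide_distrib)
  moreover have "x + y = a + (1 + \<eta>) *\<^sub>R ((1/(1+\<eta>)) *\<^sub>R x + (\<eta>/(1+\<eta>)) *\<^sub>R z - a)"
    using \<eta> by (simp add: z_def scaleR_right_diff_distrib scaleR_right_distrib add_pos_pos) (simp add: algebra_simps)
  ultimately show ?thesis by blast
qed

text \<open>A point of the small ball is the convex combination, with weights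
  \<open>1 - \<eta>\<close> and \<eta>, of \<open>x\<close> and a point of the ball of radius
  \<open>r\<close> about \<open>a\<close>.\<close>

lemma homothety_subset_interior:
  fixes K :: "'a::euclidean_space set"
  assumes "convex K" "cball a r \<subseteq> K" "r > 0" "x \<in> K" "0 < \<eta>" "\<eta> \<le> 1"
  shows "ball (a + (1 - \<eta>) *\<^sub>R (x - a)) (\<eta> * r) \<subseteq> K"
proof
  fix z assume "z \<in> ball (a + (1 - \<eta>) *\<^sub>R (x - a)) (\<eta> * r)"
  define q where "q = z - (a + (1 - \<eta>) *\<^sub>R (x - a))"
  have "norm q < \<eta> * r"
    using \<open>z \<in> _\<close> by (simp add: q_def dist_norm norm_minus_commute)
  then have "norm ((1/\<eta>) *\<^sub>R q) \<le> r" using assms by (simp add: divide_le_eq mult.commute)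
  then have "a + (1/\<eta>) *\<^sub>R q \<in> K" using assms(2) by (auto simp: dist_norm)
  then have "(1 - \<eta>) *\<^sub>R x + \<eta> *\<^sub>R (a + (1/\<eta>) *\<^sub>R q) \<in> K"
    using assms by (intro convexD[OF \<open>convex K\<close>]) auto
  also have "(1 - \<eta>) *\<^sub>R x + \<eta> *\<^sub>R (a + (1/\<eta>) *\<^sub>R q) = z"
    using assms by (simp add: q_def algebra_simps)
  finally show "z \<in> K" .
qed

text \<open>The fattened body lies in the dilate of \<open>K\<close> about \<open>a\<close> by the
  factor \<open>1 + \<delta> / r\<close>, so \<open>T\<close> lies between this dilate and the
  interior of \<open>K\<close>. The frontier of \<open>K\<close> is negligible, and the volume
  scales with the power \<open>DIM('a)\<close>.\<close>

lemma measure_offset_shell: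
  fixes K :: "'a::euclidean_space set"
  assumes K: "compact K" "convex K" "cball a r \<subseteq> K" and r: "r > 0" "0 \<le> \<delta>" "\<delta> \<le> r"
    and T: "T \<in> lmeasurable" "T \<subseteq> {x + y | x y. x \<in> K \<and> y \<in> cball 0 \<delta>} - interior K"
  shows "measure lebesgue T \<le> real DIM('a) * 2 ^ DIM('a) * (\<delta> / r) * measure lebesgue K"
proof -
  define \<eta> where "\<eta> = \<delta> / r"
  have \<eta>: "0 \<le> \<eta>" "\<eta> \<le> 1" "\<eta> * r = \<delta>" using r by (auto simp: \<eta>_def)
  define H where "H = (\<lambda>x. a + (1 + \<eta>) *\<^sub>R (x - a)) ` K"
  have H: "H \<in> lmeasurable" unfolding H_def by (intro lmeasurable_compact compact_homothety K)
  have Kint: "interior K \<in> lmeasurable"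
    using K by (simp add: lmeasurable_interior compact_imp_bounded)
  have Kint': "measure lebesgue (interior K) = measure lebesgue K"
    using K by (intro measure_interior compact_imp_bounded negligible_convex_frontier)
  have sub: "x + y \<in> H" if "x \<in> K" "norm y \<le> \<delta>" for x y
    unfolding H_def using that K r \<eta> by (intro offset_subset_homothety) auto
  have "K \<subseteq> H" using sub[of _ 0] r by auto
  then have "interior K \<subseteq> H" using interior_subset by blast
  have "T \<subseteq> H - interior K" using T(2) sub by auto
  then have "measure lebesgue T \<le> measure lebesgue (H - interior K)"
    using H Kint T by (intro measure_mono_fmeasurable) (auto intro: fmeasurable.Diff)
  also have "\<dots> = measure lebesgue H - measure lebesgue K"
    using measurable_measure_Diff[OF H _ \<open>interior K \<subseteq> H\<close>] Kint Kint' by auto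
  also have "\<dots> = ((1 + \<eta>) ^ DIM('a) - 1 ^ DIM('a)) * measure lebesgue K"
    unfolding H_def measure_homothety using \<eta> by (simp add: algebra_simps)
  also have "\<dots> \<le> (real DIM('a) * (1 + \<eta> - 1) * (1 + \<eta>) ^ (DIM('a) - 1)) * measure lebesgue K"
    using \<eta> by (intro mult_right_mono power_diff_le) auto
  also have "\<dots> \<le> (real DIM('a) * \<eta> * 2 ^ DIM('a)) * measure lebesgue K"
  proof -
    have "(1 + \<eta>) ^ (DIM('a) - 1) \<le> 2 ^ (DIM('a) - 1)" using \<eta> by (intro power_mono) auto
    also have "\<dots> \<le> (2::real) ^ DIM('a)" by (intro power_increasing) auto
    finally show ?thesis using \<eta> by (intro mult_right_mono mult_mono) auto
  qed
  finally show ?thesis by (simp add: \<eta>_def mult_ac)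
qed

lemma compact_graph_slab:
  fixes f :: "'a::euclidean_space \<Rightarrow> real"
  assumes "compact V" "continuous_on UNIV f"
  shows "compact {(v, s). v \<in> V \<and> f v \<le> s \<and> s \<le> f v + h}"
proof -
  have "compact ((\<lambda>(v, t). (v, f v + t)) ` (V \<times> {0..h}))"
    unfolding case_prod_beta
    by (intro compact_continuous_image compact_Times assms compact_Icc continuous_intros
        continuous_on_compose2[OF assms(2)]) auto
  also have "(\<lambda>(v, t). (v, f v + t)) ` (V \<times> {0..h}) = {(v, s). v \<in> V \<and> f v \<le> s \<and> s \<le> f v + h}"
    by (auto simp: image_iff) (rule_tac x="b - f a" in bexI; simp)
  finally show ?thesis .
qed

text \<open>Fubini: the fibre over each \<open>v\<close> in \<open>V\<close> is an interval of
  length \<open>h\<close>.\<close>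

lemma measure_graph_slab:
  fixes f :: "'a::euclidean_space \<Rightarrow> real"
  assumes V: "compact V" and f: "continuous_on UNIV f" and h: "0 \<le> h"
  shows "measure lebesgue {(v, s). v \<in> V \<and> f v \<le> s \<and> s \<le> f v + h} = h * measure lebesgue V"
proof -
  define G where "G = {(v, s). v \<in> V \<and> f v \<le> s \<and> s \<le> f v + h}"
  have G: "G \<in> sets (borel :: ('a \<times> real) measure)"
    unfolding G_def by (intro borel_closed compact_imp_closed compact_graph_slab assms)
  then have G': "G \<in> sets ((lborel :: 'a measure) \<Otimes>\<^sub>M (lborel :: real measure))"
    unfolding lborel_prod sets_lborel .
  have Vb: "V \<in> sets borel" using V by (intro borel_closed compact_imp_closed)
  have "emeasure lborel G = emeasure ((lborel :: 'a measure) \<Otimes>\<^sub>M (lborel :: real measure)) G"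
    by (simp add: lborel_prod)
  also have "\<dots> = (\<integral>\<^sup>+ v. emeasure lborel (Pair v -` G) \<partial>lborel)"
    by (rule lborel.emeasure_pair_measure_alt[OF G'])
  also have "\<dots> = (\<integral>\<^sup>+ v. ennreal h * indicator V v \<partial>lborel)"
  proof (intro nn_integral_cong)
    fix v :: 'a
    have "Pair v -` G = (if v \<in> V then {f v..f v + h} else {})" by (auto simp: G_def)
    then show "emeasure lborel (Pair v -` G) = ennreal h * indicator V v" using h by simp
  qed
  also have "\<dots> = ennreal h * emeasure lborel V"
    using Vb by (simp add: nn_integral_cmult)
  finally have "emeasure lborel G = ennreal h * emeasure lborel V" .
  then have "measure lborel G = h * measure lborel V"
    using h by (simp add: measure_def enn2real_mult)
  then show ?thesis using G Vb by (simp add: G_def)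
qed

section \<open>Surface area\<close>

lemma ennreal_mult_divide_cancel:
  fixes k x :: ennreal
  shows "k \<noteq> 0 \<Longrightarrow> k \<noteq> top \<Longrightarrow> k * (x / k) = x"
  by (metis ennreal_mult_divide_eq ennreal_times_divide mult.commute)

text \<open>Let \<open>D\<close> be the diameter of \<open>C\<close>. Balls of radius
  \<open>2 * D\<close> centred at steps of length \<open>D\<close> along \<open>u\<close> cover the
  tube. As \<open>D\<close> is at most \<open>w\<close>, at most \<open>2 * w / D\<close> of them
  are used, and this many balls have exactly the volume on the right.\<close>

lemma tube_measure_bound:
  fixes C :: "'a::euclidean_space set"
  assumes dim: "DIM('a) \<ge> 2" and C: "bounded C" "diameter C \<le> w" and u: "norm u = 1" and w: "w > 0"
  shows "\<exists>T\<in>lmeasurable. {x + t *\<^sub>R u | x t. x \<in> C \<and> t \<in> {0..w}} \<subseteq> T \<and>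
     measure lebesgue T \<le> unit_ball_vol (real DIM('a)) * 4 ^ DIM('a) * w * (diameter C / 2) powr (real DIM('a) - 1)"
proof (cases "C = {}")
  case True
  then show ?thesis by (auto intro!: bexI[of _ "{}"])
next
  case False
  then obtain c where c: "c \<in> C" by auto
  define D where "D = diameter C"
  have D0: "D \<ge> 0" unfolding D_def by (rule diameter_ge_0[OF C(1)])
  have inD: "dist c x \<le> D" if "x \<in> C" for x
    unfolding D_def using diameter_bounded_bound[OF C(1) c that] .
  show ?thesis
  proof (cases "D = 0")
    \<comment> \<open>The bound is 0 here, and steps of length \<open>D\<close> lead nowhere. But
      \<open>C\<close> is a single point, and the tube lies on a line, which is negligible in
      dimension at least 2.\<close>
    case True
    let ?T = "(+) c ` span {u}"
    have "dim (span {u}) < DIM('a)" using dim dim_le_card'[of "{u}"] by simp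
    then have "negligible ?T" by (intro negligible_translation negligible_lowdim)
    moreover have "{x + t *\<^sub>R u | x t. x \<in> C \<and> t \<in> {0..w}} \<subseteq> ?T"
      using inD True by (auto intro: span_base span_scale)
    ultimately show ?thesis using True
      by (intro bexI[of _ ?T]) (auto simp: negligible_imp_measurable negligible_imp_measure0 D_def)
  next
    case False
    then have D: "D > 0" using D0 by simp
    define m where "m = nat \<lfloor>w / D\<rfloor>"
    have m: "real m \<le> w / D" using w D by (simp add: m_def)
    let ?B = "\<lambda>j. cball (c + (real j * D) *\<^sub>R u) (2 * D)"
    let ?T = "\<Union>j\<in>{..m}. ?B j"
    have "{x + t *\<^sub>R u | x t. x \<in> C \<and> t \<in> {0..w}} \<subseteq> ?T"
    proof clarify
      fix x t assume xt: "x \<in> C" "t \<in> {0..w}"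
      define j where "j = nat \<lfloor>t / D\<rfloor>"
      have "t / D \<ge> 0" using xt D by simp
      then have j: "real j \<le> t / D" "t / D < real j + 1" unfolding j_def by linarith+
      have "t / D \<le> w / D" using xt D by (simp add: divide_right_mono)
      then have "j \<le> m" unfolding j_def m_def by (intro nat_mono floor_mono)
      moreover have "\<bar>t - real j * D\<bar> \<le> D" using j D by (simp add: field_simps abs_le_iff)
      moreover have "dist (c + (real j * D) *\<^sub>R u) (x + t *\<^sub>R u) \<le> dist c x + \<bar>t - real j * D\<bar>"
      proof -
        have "(c + (real j * D) *\<^sub>R u) - (x + t *\<^sub>R u) = (c - x) - (t - real j * D) *\<^sub>R u"
          by (simp add: algebra_simps)
        then show ?thesis using norm_triangle_ineq4[of "c - x" "(t - real j * D) *\<^sub>R u"] u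
          unfolding dist_norm by (simp only: norm_scaleR mult_1_right)
      qed
      ultimately have "x + t *\<^sub>R u \<in> ?B j" using inD[OF xt(1)] by simp
      then show "x + t *\<^sub>R u \<in> ?T" using \<open>j \<le> m\<close> by blast
    qed
    moreover have "?T \<in> lmeasurable" by (intro fmeasurable.finite_UN) auto
    moreover have "measure lebesgue ?T \<le> unit_ball_vol (real DIM('a)) * 4 ^ DIM('a) * w * (D / 2) powr (real DIM('a) - 1)"
    proof -
      have "measure lebesgue ?T \<le> (\<Sum>j\<in>{..m}. measure lebesgue (?B j))"
        by (intro measure_UNION_le) auto
      also have "\<dots> = (real m + 1) * (unit_ball_vol (real DIM('a)) * (2 * D) ^ DIM('a))"
        using D by (simp add: content_cball)
      also have "\<dots> \<le> (2 * (w / D)) * (unit_ball_vol (real DIM('a)) * (2 * D) ^ DIM('a))"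
      proof (intro mult_right_mono)
        have "1 \<le> w / D" using C D by (simp add: D_def)
        then show "real m + 1 \<le> 2 * (w / D)" using m by linarith
      qed (use D in auto)
      also have "\<dots> = unit_ball_vol (real DIM('a)) * 4 ^ DIM('a) * w * (D / 2) powr (real DIM('a) - 1)"
      proof -
        obtain n where n: "DIM('a) = Suc n" using dim by (cases "DIM('a)") auto
        have "(4::real) ^ n = 2 ^ n * 2 ^ n" by (simp flip: power_mult_distrib)
        then show ?thesis using D
          by (simp add: n powr_realpow power_mult_distrib power_divide field_simps)
      qed
      finally show ?thesis .
    qed
    ultimately show ?thesis unfolding D_def by blast
  qed
qed

text \<open>Quotient of the constant of the tube bound by the normalising factor of the Hausdorff
  measure of dimension \<open>n - 1\<close>.\<close>

definition cauchy_const :: "nat \<Rightarrow> real" where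
  "cauchy_const n = unit_ball_vol (real n) * 4 ^ n / unit_ball_vol (real n - 1)"

text \<open>Every point of \<open>K\<close> reaches the boundary by moving at most \<open>w\<close> in direction \<open>-u\<close>, so the tubes over a
  cover of the boundary cover \<open>K\<close>.\<close>

lemma volume_le_width_surface:
  fixes K :: "'a::euclidean_space set"
  assumes dim: "DIM('a) \<ge> 2" and K: "compact K" and u: "norm u = 1" and w: "w > 0"
    and width: "\<And>x y. x \<in> K \<Longrightarrow> y \<in> K \<Longrightarrow> u \<bullet> x - u \<bullet> y \<le> w"
  shows "emeasure lebesgue K \<le> ennreal (cauchy_const DIM('a) * w) * surface_area K"
proof -
  let ?s = "real DIM('a) - 1"
  let ?\<omega> = "unit_ball_vol ?s"
  have \<omega>: "?\<omega> > 0" using dim by (intro unit_ball_vol_pos) auto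
  let ?k = "cauchy_const DIM('a) * w"
  have k: "?k > 0" using w dim \<omega> by (auto simp: cauchy_const_def intro!: mult_pos_pos divide_pos_pos unit_ball_vol_pos)
  \<comment> \<open>Dividing the volume by \<open>?k\<close> makes it a lower bound of the sums
    whose infimum is \<open>hausdorff_pre\<close>.\<close>
  have cover: "emeasure lebesgue K / ennreal ?k \<le> (\<Sum>i. ennreal (?\<omega> * (diameter (C i) / 2) powr ?s))"
    if C: "frontier K \<subseteq> (\<Union>i. C i)" "\<And>i. bounded (C i) \<and> diameter (C i) \<le> w" for C :: "nat \<Rightarrow> 'a set"
  proof -
    have *: "\<exists>T. T \<in> lmeasurable \<and> {x + t *\<^sub>R u | x t. x \<in> C i \<and> t \<in> {0..w}} \<subseteq> T \<and>
     measure lebesgue T \<le> unit_ball_vol (real DIM('a)) * 4 ^ DIM('a) * w * (diameter (C i) / 2) powr ?s" for i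
      using tube_measure_bound[OF dim _ _ u w, of "C i"] C(2)[of i] unfolding Bex_def by simp
    have "\<exists>T. \<forall>i. T i \<in> lmeasurable \<and> {x + t *\<^sub>R u | x t. x \<in> C i \<and> t \<in> {0..w}} \<subseteq> T i \<and>
     measure lebesgue (T i) \<le> unit_ball_vol (real DIM('a)) * 4 ^ DIM('a) * w * (diameter (C i) / 2) powr ?s"
      by (intro choice allI *)
    then obtain T where T: "\<And>i. T i \<in> lmeasurable"
      "\<And>i. {x + t *\<^sub>R u | x t. x \<in> C i \<and> t \<in> {0..w}} \<subseteq> T i"
      "\<And>i. measure lebesgue (T i) \<le> unit_ball_vol (real DIM('a)) * 4 ^ DIM('a) * w * (diameter (C i) / 2) powr ?s"
      by blast
    have sub: "K \<subseteq> (\<Union>i. T i)"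
    proof
      fix y assume y: "y \<in> K"
      have "\<exists>x\<in>frontier K. \<exists>t\<in>{0..w}. y = x + t *\<^sub>R u"
      proof (cases "y \<in> interior K")
        case False
        then have "y \<in> frontier K" using y by (simp add: frontier_def closure_subset[THEN subsetD])
        then show ?thesis using w by (intro bexI[of _ y] bexI[of _ 0]) auto
      next
        case True
        have "- u \<noteq> 0" using u by auto
        then obtain d where d: "0 < d" "y + d *\<^sub>R (- u) \<in> frontier K"
          using ray_to_frontier[OF compact_imp_bounded[OF K] True] by blast
        have "y + d *\<^sub>R (- u) \<in> K" using d(2) K frontier_subset_compact by blast
        from width[OF y this] have "d \<le> w" using u by (simp add: inner_diff_right norm_eq_1)
        then show ?thesis using d by (intro bexI[OF _ d(2)] bexI[of _ d]) auto
      qed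
      then obtain x t where xt: "x \<in> frontier K" "t \<in> {0..w}" "y = x + t *\<^sub>R u" by blast
      then obtain i where "x \<in> C i" using C(1) by blast
      then show "y \<in> (\<Union>i. T i)" using T(2)[of i] xt by blast
    qed
    have "emeasure lebesgue K \<le> emeasure lebesgue (\<Union>i. T i)"
      using sub T(1) by (intro emeasure_mono sets.countable_UN) auto
    also have "\<dots> \<le> (\<Sum>i. emeasure lebesgue (T i))"
      using T(1) by (intro emeasure_subadditive_countably) auto
    also have "\<dots> \<le> (\<Sum>i. ennreal ?k * ennreal (?\<omega> * (diameter (C i) / 2) powr ?s))"
    proof (intro suminf_le allI)
      fix i
      have "emeasure lebesgue (T i) = ennreal (measure lebesgue (T i))"
        using T(1) by (rule emeasure_eq_measure2)
      also have "\<dots> \<le> ennreal (?k * (?\<omega> * (diameter (C i) / 2) powr ?s))"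
      proof (intro ennreal_leI)
        have "?k * (?\<omega> * (diameter (C i) / 2) powr ?s)
            = unit_ball_vol (real DIM('a)) * 4 ^ DIM('a) * w * (diameter (C i) / 2) powr ?s"
          using less_imp_neq[OF \<omega>] by (simp only: cauchy_const_def) (simp add: field_simps)
        then show "measure lebesgue (T i) \<le> ?k * (?\<omega> * (diameter (C i) / 2) powr ?s)"
          using T(3)[of i] by (simp only:)
      qed
      also have "\<dots> = ennreal ?k * ennreal (?\<omega> * (diameter (C i) / 2) powr ?s)"
        using k \<omega> by (intro ennreal_mult) auto
      finally show "emeasure lebesgue (T i) \<le> ennreal ?k * ennreal (?\<omega> * (diameter (C i) / 2) powr ?s)" .
    qed auto
    also have "\<dots> = ennreal ?k * (\<Sum>i. ennreal (?\<omega> * (diameter (C i) / 2) powr ?s))"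
      by (rule ennreal_suminf_cmult)
    finally show ?thesis
      using k by (intro divide_le_posI_ennreal) auto
  qed
  \<comment> \<open>The single scale \<open>w\<close> suffices: its covers are those the tube bound
    admits, and the Hausdorff measure dominates the premeasure at every scale.\<close>
  have "emeasure lebesgue K / ennreal ?k \<le> hausdorff_pre ?s w (frontier K)"
    unfolding hausdorff_pre_def using cover by (intro INF_greatest) auto
  also have "\<dots> \<le> surface_area K"
    unfolding surface_area_def hausdorff_measure_def using w by (intro SUP_upper) auto
  finally have "ennreal ?k * (emeasure lebesgue K / ennreal ?k) \<le> ennreal ?k * surface_area K"
    by (rule mult_left_mono) simp
  moreover have "ennreal ?k * (emeasure lebesgue K / ennreal ?k) = emeasure lebesgue K"
    using k by (intro ennreal_mult_divide_cancel) auto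
  ultimately show ?thesis by simp
qed

text \<open>Take a maximal subset of the frontier with mutual distances at least
  \<open>2 * \<rho>\<close>. The balls of radius \<rho> about its points are disjoint and lie in a
  shell of volume proportional to \<rho>, so their number is at most a constant divided by
  \<open>\<rho> ^ (n - 1)\<close>. The balls of twice the radius cover the frontier, with a sum
  bounded independently of \<delta>.\<close>

lemma surface_area_finite:
  fixes K :: "'a::euclidean_space set"
  assumes "convex_body K"
  shows "surface_area K < \<infinity>"
proof -
  have K: "compact K" "convex K" "interior K \<noteq> {}" using assms by (auto simp: convex_body_def)
  then obtain a where "a \<in> interior K" by auto
  then obtain r where r: "r > 0" "cball a r \<subseteq> K" by (meson mem_interior_cball)
  let ?n = "DIM('a)"
  let ?V = "measure lebesgue K"
  define X where "X = real ?n * 2 ^ ?n * ?V / (r * unit_ball_vol (real ?n))"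
  have \<omega>: "unit_ball_vol (real ?n) > 0" by (intro unit_ball_vol_pos) auto
  have \<omega>1: "unit_ball_vol (real ?n - 1) \<ge> 0" by (rule unit_ball_vol_nonneg) (simp add: DIM_positive Suc_leI)
  have pow: "x ^ ?n = x * x ^ (?n - 1)" for x :: real
    using power_minus_mult[OF DIM_positive[where 'a='a], of x] by (simp add: mult.commute)
  define M where "M = X * (unit_ball_vol (real ?n - 1) * 2 ^ (?n - 1))"
  have "hausdorff_pre (real ?n - 1) \<delta> (frontier K) \<le> ennreal M" if \<delta>: "\<delta> > 0" for \<delta>
  proof -
    \<comment> \<open>The bound 1 is for the inner dilate \<open>J\<close>. The bound
      \<open>\<delta> / (4 * r)\<close> makes the diameter \<open>4 * \<rho>\<close> of the covering
      balls at most \<delta>.\<close>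
    define \<eta> where "\<eta> = min 1 (\<delta> / (4 * r))"
    define \<rho> where "\<rho> = \<eta> * r"
    have \<eta>: "0 < \<eta>" "\<eta> \<le> 1" "\<rho> > 0" using r \<delta> by (auto simp: \<eta>_def \<rho>_def)
    have "\<eta> \<le> \<delta> / (4 * r)" by (simp add: \<eta>_def)
    then have \<rho>\<delta>: "4 * \<rho> \<le> \<delta>" using r by (simp add: \<rho>_def field_simps)
    define H where "H = (\<lambda>x. a + (1 + \<eta>) *\<^sub>R (x - a)) ` K"
    define J where "J = (\<lambda>x. a + (1 - \<eta>) *\<^sub>R (x - a)) ` K"
    have HJ: "H \<in> lmeasurable" "J \<in> lmeasurable"
      unfolding H_def J_def by (intro lmeasurable_compact compact_homothety K)+
    have ballsub: "ball x \<rho> \<subseteq> H - J" if x: "x \<in> frontier K" for x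
    proof
      fix y assume y: "y \<in> ball x \<rho>"
      have xK: "x \<in> K" "x \<notin> interior K" using x K frontier_subset_compact by (auto simp: frontier_def)
      have "x + (y - x) \<in> H" unfolding H_def
        using K r xK \<eta> y by (intro offset_subset_homothety) (auto simp: \<rho>_def dist_norm norm_minus_commute)
      \<comment> \<open>A point of \<open>J\<close> is the centre of a ball of radius \<rho> inside
        \<open>K\<close>, which would make \<open>x\<close> an interior point.\<close>
      moreover have "y \<notin> J"
      proof
        assume "y \<in> J"
        then have "ball y \<rho> \<subseteq> K"
          unfolding J_def \<rho>_def using homothety_subset_interior[OF K(2) r(2,1) _ \<eta>(1,2)] by blast
        moreover have "x \<in> ball y \<rho>" using y by (simp add: dist_commute)
        ultimately show False using xK(2) interior_maximal[OF _ open_ball] by blast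
      qed
      ultimately show "y \<in> H - J" by simp
    qed
    have meas: "measure lebesgue (H - J) \<le> X * unit_ball_vol (real ?n) * \<rho>"
    proof -
      have "K \<subseteq> H" using offset_subset_homothety[OF K(2) r(2,1) _ _ less_imp_le[OF \<eta>(1)], of _ 0] \<eta> r
        by (auto simp: H_def)
      moreover have "J \<subseteq> K"
      proof
        fix y assume "y \<in> J"
        then have "ball y (\<eta> * r) \<subseteq> K"
          unfolding J_def using homothety_subset_interior[OF K(2) r(2,1) _ \<eta>(1,2)] by blast
        then show "y \<in> K" using \<eta> r by auto
      qed
      ultimately have "J \<subseteq> H" by blast
      then have "measure lebesgue (H - J) = measure lebesgue H - measure lebesgue J"
        using HJ by (intro measurable_measure_Diff) auto
      also have "\<dots> = ((1 + \<eta>) ^ ?n - (1 - \<eta>) ^ ?n) * ?V"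
        unfolding H_def J_def measure_homothety using \<eta> by (simp add: algebra_simps)
      also have "\<dots> \<le> (real ?n * (1 + \<eta> - (1 - \<eta>)) * (1 + \<eta>) ^ (?n - 1)) * ?V"
        using \<eta> by (intro mult_right_mono power_diff_le) auto
      also have "\<dots> \<le> (real ?n * (2 * \<eta>) * 2 ^ (?n - 1)) * ?V"
        using \<eta> by (intro mult_right_mono mult_mono power_mono) auto
      also have "\<dots> = real ?n * \<eta> * 2 ^ ?n * ?V"
        by (simp only: pow[of 2] mult_ac)
      also have "\<dots> = X * unit_ball_vol (real ?n) * \<rho>"
        using r(1) less_imp_neq[OF \<omega>] by (simp only: X_def \<rho>_def) (simp add: field_simps)
      finally show ?thesis .
    qed
    obtain F where F: "finite F" "F \<subseteq> frontier K" "real (card F) \<le> X / \<rho> ^ (?n - 1)"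
      "\<And>x. x \<in> frontier K \<Longrightarrow> \<exists>y\<in>F. dist x y < 2 * \<rho> \<or> dist y x < 2 * \<rho>"
    proof (rule finite_maximal_selection[of "frontier K" "\<lambda>x y. dist x y < 2 * \<rho>" "X / \<rho> ^ (?n - 1)"])
      fix F assume F: "finite F" "F \<subseteq> frontier K"
        "pairwise (\<lambda>x y. \<not> dist x y < 2 * \<rho> \<and> \<not> dist y x < 2 * \<rho>) F"
      have "real (card F) * (unit_ball_vol (real ?n) * \<rho> ^ ?n) \<le> measure lebesgue (H - J)"
      proof (rule card_packing_le[OF F(1), of "\<lambda>x. ball x \<rho>"])
        show "pairwise (\<lambda>x y. disjnt (ball x \<rho>) (ball y \<rho>)) F"
          using F(3) by (rule pairwise_mono) (auto simp: disjnt_def intro!: disjoint_ballI)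
      qed (use F ballsub HJ \<eta> in \<open>auto simp: content_ball intro: fmeasurable.Diff\<close>)
      also have "\<dots> \<le> X * unit_ball_vol (real ?n) * \<rho>" by (rule meas)
      finally have "(real (card F) * \<rho> ^ (?n - 1)) * (unit_ball_vol (real ?n) * \<rho>) \<le> X * (unit_ball_vol (real ?n) * \<rho>)"
        by (simp only: pow[of \<rho>] mult_ac)
      then have "real (card F) * \<rho> ^ (?n - 1) \<le> X" using \<omega> \<eta> by (subst (asm) mult_le_cancel_right_pos) auto
      then show "real (card F) \<le> X / \<rho> ^ (?n - 1)" using \<eta> by (simp add: pos_le_divide_eq)
    qed (use \<eta> in auto)
    obtain xs where xs: "set xs = F" "distinct xs" using finite_distinct_list[OF F(1)] by blast
    \<comment> \<open>The empty set pads the finite cover to a sequence. It contributes 0 even for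
      the exponent 0 of dimension 1, because \<open>0 powr 0 = 0\<close>.\<close>
    define C where "C i = (if i < length xs then ball (xs ! i) (2 * \<rho>) else {})" for i
    have "frontier K \<subseteq> (\<Union>i. C i)"
    proof
      fix x assume "x \<in> frontier K"
      then obtain y where "y \<in> F" "x \<in> ball y (2 * \<rho>)"
        using F(4)[of x] by (auto simp: dist_commute)
      then obtain i where "i < length xs" "xs ! i = y" using xs by (metis in_set_conv_nth)
      then show "x \<in> (\<Union>i. C i)" using \<open>x \<in> ball y (2 * \<rho>)\<close> by (auto simp: C_def intro!: exI[of _ i])
    qed
    moreover have "bounded (C i) \<and> diameter (C i) \<le> \<delta>" for i
      using \<rho>\<delta> \<eta> \<delta> by (auto simp: C_def)
    ultimately have "hausdorff_pre (real ?n - 1) \<delta> (frontier K)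
        \<le> (\<Sum>i. ennreal (unit_ball_vol (real ?n - 1) * (diameter (C i) / 2) powr (real ?n - 1)))"
      unfolding hausdorff_pre_def by (intro INF_lower) auto
    also have "\<dots> = (\<Sum>i<length xs. ennreal (unit_ball_vol (real ?n - 1) * (diameter (C i) / 2) powr (real ?n - 1)))"
      by (intro suminf_finite) (auto simp: C_def)
    also have "\<dots> = (\<Sum>i<length xs. ennreal (unit_ball_vol (real ?n - 1) * (2 * \<rho>) ^ (?n - 1)))"
    proof (intro sum.cong refl)
      fix i assume "i \<in> {..<length xs}"
      then have "diameter (C i) / 2 = 2 * \<rho>" using \<eta> by (simp add: C_def)
      moreover have "(2 * \<rho>) powr (real ?n - 1) = (2 * \<rho>) ^ (?n - 1)"
        using \<eta> powr_realpow[of "2 * \<rho>" "?n - 1"] by (simp add: of_nat_diff DIM_positive Suc_leI)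
      ultimately show "ennreal (unit_ball_vol (real ?n - 1) * (diameter (C i) / 2) powr (real ?n - 1))
          = ennreal (unit_ball_vol (real ?n - 1) * (2 * \<rho>) ^ (?n - 1))" by simp
    qed
    also have "\<dots> = ennreal (real (card F) * (unit_ball_vol (real ?n - 1) * (2 * \<rho>) ^ (?n - 1)))"
      using xs \<eta> \<omega>1 by (simp add: ennreal_mult distinct_card[symmetric] ennreal_of_nat_eq_real_of_nat)
    also have "\<dots> \<le> ennreal (X / \<rho> ^ (?n - 1) * (unit_ball_vol (real ?n - 1) * (2 * \<rho>) ^ (?n - 1)))"
      using F(3) \<eta> \<omega>1 by (intro ennreal_leI mult_right_mono) auto
    also have "X / \<rho> ^ (?n - 1) * (unit_ball_vol (real ?n - 1) * (2 * \<rho>) ^ (?n - 1)) = M"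
      using \<eta> by (simp add: M_def power_mult_distrib)
    finally show ?thesis .
  qed
  then have "surface_area K \<le> ennreal M"
    unfolding surface_area_def hausdorff_measure_def by (intro SUP_least) auto
  also have "\<dots> < \<infinity>" by simp
  finally show ?thesis .
qed

section \<open>Scaling of the Hausdorff measure, and the surface diameter\<close>

lemma diameter_scaleR_le:
  fixes S :: "'a::real_normed_vector set"
  assumes "bounded S" "c \<ge> 0"
  shows "diameter ((*\<^sub>R) c ` S) \<le> c * diameter S"
proof (rule diameter_le)
  show "(*\<^sub>R) c ` S \<noteq> {} \<or> 0 \<le> c * diameter S"
    using assms diameter_ge_0 by auto
  fix x y assume "x \<in> (*\<^sub>R) c ` S" "y \<in> (*\<^sub>R) c ` S"
  then obtain x' y' where xy: "x = c *\<^sub>R x'" "y = c *\<^sub>R y'" "x' \<in> S" "y' \<in> S" by auto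
  have "dist x' y' \<le> diameter S" using diameter_bounded_bound[OF assms(1) xy(3,4)] .
  then have "c * norm (x' - y') \<le> c * diameter S" using assms by (intro mult_left_mono) (auto simp: dist_norm)
  then show "norm (x - y) \<le> c * diameter S" using assms xy by (simp flip: scaleR_diff_right)
qed

text \<open>Scaling by \<open>c\<close> turns a cover at scale \<open>\<delta> / c\<close> into a
  cover of the image at scale \<delta> and multiplies each summand by at most
  \<open>c powr s\<close>.\<close>

lemma hausdorff_measure_scaleR_le:
  fixes A :: "'a::real_normed_vector set"
  assumes c: "c > 0" and s: "s \<ge> 0"
  shows "hausdorff_measure s ((*\<^sub>R) c ` A) \<le> ennreal (c powr s) * hausdorff_measure s A"
proof -
  let ?k = "ennreal (c powr s)"
  have k: "?k > 0" "?k \<noteq> 0" "?k \<noteq> top" using c by auto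
  have "hausdorff_pre s \<delta> ((*\<^sub>R) c ` A) \<le> ?k * hausdorff_measure s A" if "\<delta> > 0" for \<delta>
  proof -
    have "hausdorff_pre s \<delta> ((*\<^sub>R) c ` A) / ?k \<le> hausdorff_pre s (\<delta> / c) A"
      unfolding hausdorff_pre_def[of s "\<delta> / c" A]
    proof (intro INF_greatest divide_le_posI_ennreal k(1))
      fix C assume "C \<in> {C :: nat \<Rightarrow> 'a set. A \<subseteq> (\<Union>i. C i) \<and> (\<forall>i. bounded (C i) \<and> diameter (C i) \<le> \<delta> / c)}"
      then have C: "A \<subseteq> (\<Union>i. C i)" "\<And>i. bounded (C i)" "\<And>i. diameter (C i) \<le> \<delta> / c" by auto
      have d: "diameter ((*\<^sub>R) c ` C i) \<le> c * diameter (C i)" for i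
        using C c by (intro diameter_scaleR_le) auto
      have "c * diameter (C i) \<le> \<delta>" for i using C(3)[of i] c by (simp add: field_simps)
      then have "hausdorff_pre s \<delta> ((*\<^sub>R) c ` A)
          \<le> (\<Sum>i. ennreal (unit_ball_vol s * (diameter ((*\<^sub>R) c ` C i) / 2) powr s))"
      proof -
        have "(*\<^sub>R) c ` A \<subseteq> (\<Union>i. (*\<^sub>R) c ` C i)" using C(1) by blast
        moreover have "bounded ((*\<^sub>R) c ` C i) \<and> diameter ((*\<^sub>R) c ` C i) \<le> \<delta>" for i
          using C(2)[of i] order_trans[OF d \<open>\<And>i. c * diameter (C i) \<le> \<delta>\<close>] by (simp add: bounded_scaling)
        ultimately show ?thesis
          unfolding hausdorff_pre_def by (intro INF_lower) simp
      qed
      also have "\<dots> \<le> (\<Sum>i. ?k * ennreal (unit_ball_vol s * (diameter (C i) / 2) powr s))"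
      proof (intro suminf_le allI)
        fix i
        have "(diameter ((*\<^sub>R) c ` C i) / 2) powr s \<le> (c * (diameter (C i) / 2)) powr s"
          using d[of i] c s C(2) by (intro powr_mono2) (auto intro!: diameter_ge_0 bounded_scaling)
        also have "\<dots> = c powr s * (diameter (C i) / 2) powr s"
          using c C(2) by (intro powr_mult)
        finally have "unit_ball_vol s * (diameter ((*\<^sub>R) c ` C i) / 2) powr s
            \<le> unit_ball_vol s * (c powr s * (diameter (C i) / 2) powr s)"
          by (rule mult_left_mono[OF _ unit_ball_vol_nonneg[OF s]])
        also have "\<dots> = c powr s * (unit_ball_vol s * (diameter (C i) / 2) powr s)" by simp
        finally show "ennreal (unit_ball_vol s * (diameter ((*\<^sub>R) c ` C i) / 2) powr s)
            \<le> ?k * ennreal (unit_ball_vol s * (diameter (C i) / 2) powr s)"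
          using unit_ball_vol_nonneg[OF s] by (simp flip: ennreal_mult)
      qed auto
      also have "\<dots> = ?k * (\<Sum>i. ennreal (unit_ball_vol s * (diameter (C i) / 2) powr s))"
        by (rule ennreal_suminf_cmult)
      finally show "hausdorff_pre s \<delta> ((*\<^sub>R) c ` A)
          \<le> ?k * (\<Sum>i. ennreal (unit_ball_vol s * (diameter (C i) / 2) powr s))" .
    qed
    also have "\<dots> \<le> hausdorff_measure s A"
      unfolding hausdorff_measure_def using that c by (intro SUP_upper) auto
    finally have "?k * (hausdorff_pre s \<delta> ((*\<^sub>R) c ` A) / ?k) \<le> ?k * hausdorff_measure s A"
      by (rule mult_left_mono) simp
    then show ?thesis by (simp only: ennreal_mult_divide_cancel[OF k(2,3)])
  qed
  then show ?thesis unfolding hausdorff_measure_def[of s "(*\<^sub>R) c ` A"] by (intro SUP_least) auto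
qed

text \<open>The reverse inequality is the same bound applied to scaling back by
  \<open>1/c\<close>.\<close>

lemma hausdorff_measure_scaleR:
  fixes A :: "'a::real_normed_vector set"
  assumes c: "c > 0" and s: "s \<ge> 0"
  shows "hausdorff_measure s ((*\<^sub>R) c ` A) = ennreal (c powr s) * hausdorff_measure s A"
proof (rule antisym)
  show "hausdorff_measure s ((*\<^sub>R) c ` A) \<le> ennreal (c powr s) * hausdorff_measure s A"
    by (rule hausdorff_measure_scaleR_le[OF assms])
  have "hausdorff_measure s ((*\<^sub>R) (1/c) ` (*\<^sub>R) c ` A) \<le> ennreal ((1/c) powr s) * hausdorff_measure s ((*\<^sub>R) c ` A)"
    using assms by (intro hausdorff_measure_scaleR_le) auto
  also have "(*\<^sub>R) (1/c) ` (*\<^sub>R) c ` A = A" using c by (auto simp: image_image)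
  finally have "ennreal (c powr s) * hausdorff_measure s A
      \<le> ennreal (c powr s) * (ennreal ((1/c) powr s) * hausdorff_measure s ((*\<^sub>R) c ` A))"
    by (rule mult_left_mono) simp
  also have "\<dots> = ennreal (c powr s * (1/c) powr s) * hausdorff_measure s ((*\<^sub>R) c ` A)"
    by (simp add: ennreal_mult mult.assoc)
  also have "c powr s * (1/c) powr s = 1" using c by (simp flip: powr_mult)
  finally show "ennreal (c powr s) * hausdorff_measure s A \<le> hausdorff_measure s ((*\<^sub>R) c ` A)" by simp
qed

lemma surface_area_ball:
  assumes dim: "DIM('a::euclidean_space) \<ge> 2" and "R \<ge> 0"
  shows "surface_area (ball (0::'a) R) = ennreal (R powr (real DIM('a) - 1)) * surface_area (ball (0::'a) 1)"
proof (cases "R = 0")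
  \<comment> \<open>Both sides vanish: the open ball of radius 0 is empty, and
    \<open>0 powr s\<close> is 0.\<close>
  case True
  have pre: "hausdorff_pre s \<delta> ({} :: 'a set) \<le> 0" if "\<delta> > 0" for s \<delta> :: real
  proof -
    have "hausdorff_pre s \<delta> ({} :: 'a set) \<le> (\<Sum>i::nat. ennreal (unit_ball_vol s * (diameter ({}::'a set) / 2) powr s))"
      unfolding hausdorff_pre_def using that by (intro INF_lower2[of "\<lambda>_. {}"]) auto
    then show ?thesis by simp
  qed
  have "hausdorff_measure s ({} :: 'a set) \<le> 0" for s
    unfolding hausdorff_measure_def by (intro SUP_least pre) simp
  then show ?thesis using True by (simp add: surface_area_def)
next
  case False
  then have R: "R > 0" using assms by simp
  have "frontier (ball (0::'a) R) = (*\<^sub>R) R ` frontier (ball 0 1)"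
  proof -
    have "x \<in> (*\<^sub>R) R ` sphere 0 1" if "norm x = R" for x :: 'a
      using that R by (intro image_eqI[of _ _ "(1/R) *\<^sub>R x"]) auto
    then show ?thesis using R by auto
  qed
  then show ?thesis unfolding surface_area_def
    using R dim by (simp add: hausdorff_measure_scaleR)
qed

text \<open>If the surface area were zero, the sweeping bound, used with a crude bound on the width,
  would make \<open>K\<close> negligible in spite of its interior points.\<close>

lemma surface_area_pos:
  fixes K :: "'a::euclidean_space set"
  assumes dim: "DIM('a) \<ge> 2" and "convex_body K"
  shows "surface_area K > 0"
proof (rule ccontr)
  assume "\<not> surface_area K > 0"
  then have S0: "surface_area K = 0" by simp
  have K: "compact K" "convex K" "interior K \<noteq> {}" using assms by (auto simp: convex_body_def)
  obtain u :: 'a where u: "norm u = 1" using vector_choose_size[of 1] by auto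
  obtain B where B: "\<And>x. x \<in> K \<Longrightarrow> norm x \<le> B" "B > 0"
    using compact_imp_bounded[OF K(1)] by (auto simp: bounded_pos)
  have "u \<bullet> x - u \<bullet> y \<le> 2 * B" if "x \<in> K" "y \<in> K" for x y
    using Cauchy_Schwarz_ineq2[of u x] Cauchy_Schwarz_ineq2[of u y] B(1)[OF that(1)] B(1)[OF that(2)] u
    by (simp add: abs_le_iff)
  then have "emeasure lebesgue K \<le> 0"
    using volume_le_width_surface[OF dim K(1) u, of "2 * B"] B S0 by simp
  then have "negligible K"
    using K(1) by (simp add: negligible_iff_emeasure0 lmeasurable_compact fmeasurableD)
  then show False using K by (simp add: negligible_convex_interior)
qed

text \<open>This resolves the definite description: for \<open>E\<close> at least 0 the ball of
  radius \<open>E / 2\<close> has area \<open>(E / 2) powr ?s * \<sigma>\<close> with a finite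
  \<sigma> > 0, and this takes each positive value exactly once.\<close>

lemma surface_diameter_spec:
  fixes K :: "'a::euclidean_space set"
  assumes dim: "DIM('a) \<ge> 2" and K: "convex_body K"
  shows "surface_diameter K \<ge> 0"
    and "surface_area K
           = ennreal ((surface_diameter K / 2) powr (real DIM('a) - 1)) * surface_area (ball (0::'a) 1)"
proof -
  let ?s = "real DIM('a) - 1"
  have s: "?s > 0" using dim by simp
  \<comment> \<open>The open ball is not compact, but it shares its frontier with the closed ball,
    which is a convex body.\<close>
  have "surface_area (ball (0::'a) 1) = surface_area (cball (0::'a) 1)"
    by (simp add: surface_area_def)
  moreover have "convex_body (cball (0::'a) 1)" by (simp add: convex_body_def)
  ultimately have "surface_area (ball (0::'a) 1) > 0" "surface_area (ball (0::'a) 1) < \<infinity>"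
    using surface_area_pos[OF dim] surface_area_finite by metis+
  then obtain \<sigma> where \<sigma>: "surface_area (ball (0::'a) 1) = ennreal \<sigma>" "\<sigma> > 0"
    by (cases "surface_area (ball (0::'a) 1)") (auto simp: less_le)
  obtain S where S: "surface_area K = ennreal S" "S > 0"
    using surface_area_pos[OF dim K] surface_area_finite[OF K]
    by (cases "surface_area K") (auto simp: less_le)
  define D where "D = 2 * (S / \<sigma>) powr (1 / ?s)"
  have area: "surface_area (ball (0::'a) (E / 2)) = ennreal ((E / 2) powr ?s * \<sigma>)" if "E \<ge> 0" for E
    using surface_area_ball[OF dim, of "E / 2"] that \<sigma> by (simp add: ennreal_mult)
  have "(D / 2) powr ?s = S / \<sigma>" using s S \<sigma> by (simp add: D_def powr_powr)
  then have D: "D \<ge> 0" "surface_area (ball (0::'a) (D / 2)) = surface_area K"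
    using area[of D] S \<sigma> by (auto simp: D_def)
  have "E = D" if "E \<ge> 0" "surface_area (ball (0::'a) (E / 2)) = surface_area K" for E
  proof -
    have "(E / 2) powr ?s * \<sigma> = S" using that area[OF that(1)] S \<sigma> by simp
    then have "(E / 2) powr ?s = S / \<sigma>" using \<sigma> by (simp add: field_simps)
    then have "E / 2 = (S / \<sigma>) powr (1 / ?s)" 
      using that s powr_powr[of "E / 2" ?s "1 / ?s"] by simp
    then show ?thesis by (simp add: D_def)
  qed
  then have eq: "surface_diameter K = D"
    unfolding surface_diameter_def using D by (intro the_equality conjI) blast+
  show "surface_diameter K \<ge> 0" unfolding eq by (rule D(1))
  have "surface_area K = ennreal ((D / 2) powr ?s * \<sigma>)" using area[OF D(1)] unfolding D(2) .
  also have "\<dots> = ennreal ((D / 2) powr ?s) * ennreal \<sigma>" using \<sigma>(2) by (intro ennreal_mult) auto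
  finally show "surface_area K = ennreal ((surface_diameter K / 2) powr ?s) * surface_area (ball (0::'a) 1)"
    unfolding eq \<sigma>(1) .
qed

section \<open>Widths and inscribed balls\<close>

lemma width_attained:
  fixes K :: "'a::euclidean_space set"
  assumes "compact K" "K \<noteq> {}"
  obtains x y where "x \<in> K" "y \<in> K" "width K u = u \<bullet> x - u \<bullet> y"
    "\<And>x' y'. x' \<in> K \<Longrightarrow> y' \<in> K \<Longrightarrow> u \<bullet> x' - u \<bullet> y' \<le> width K u"
proof -
  have c: "continuous_on K (\<lambda>x. u \<bullet> x)" by (intro continuous_intros)
  obtain x where x: "x \<in> K" "\<And>z. z \<in> K \<Longrightarrow> u \<bullet> z \<le> u \<bullet> x"
    using continuous_attains_sup[OF assms c] by blast
  obtain y where y: "y \<in> K" "\<And>z. z \<in> K \<Longrightarrow> u \<bullet> y \<le> u \<bullet> z"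
    using continuous_attains_inf[OF assms c] by blast
  have "(SUP x\<in>K. u \<bullet> x) = u \<bullet> x" using x by (intro cSup_eq_maximum) auto
  moreover have "(INF x\<in>K. u \<bullet> x) = u \<bullet> y" using y by (intro cInf_eq_minimum) auto
  ultimately have "width K u = u \<bullet> x - u \<bullet> y" by (simp add: width_def)
  then show ?thesis using that[of x y] x y by (simp add: diff_mono)
qed

text \<open>The outer box of \<open>K\<close> bounds the width in direction \<open>b i\<close> by
  \<open>2 * r i\<close>, so each \<open>r i\<close> is at least \<open>w / 2\<close>, and the inner
  box contains a ball of the required radius.\<close>

lemma inball_of_width:
  fixes K :: "'a::euclidean_space set"
  assumes K: "convex_body K" and w: "\<And>u. norm u = 1 \<Longrightarrow> w \<le> width K u"
  shows "\<exists>a. cball a (box_ratio DIM('a) * w / 2) \<subseteq> K"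
proof -
  let ?c = "box_ratio DIM('a)"
  have c: "?c > 0" by (simp add: box_ratio_pos)
  have K': "compact K" "convex K" "interior K \<noteq> {}" using K by (auto simp: convex_body_def)
  then obtain a where a: "a \<in> K" using interior_subset by blast
  then have Kne: "K \<noteq> {}" by auto
  define A where "A = (\<lambda>x. x - a) ` K"
  have A4: "interior A \<noteq> {}" unfolding A_def using K'(3) by (simp add: interior_translation_subtract)
  have A12: "compact A" "convex A" unfolding A_def using K'
    by (simp_all add: compact_translation_subtract convex_translation_subtract)
  have "0 \<in> A" using a by (auto simp: A_def)
  obtain b r g where *: "orthonormal_frame b" "A \<subseteq> frame_box b r"
    "\<And>z. z \<in> frame_box b (\<lambda>i. ?c * r i) \<Longrightarrow> g + z \<in> A"
    by (rule convex_body_frame_box[OF A12 \<open>0 \<in> A\<close> A4]) blast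
  have r: "w / 2 \<le> r i" if i: "i \<in> Basis" for i
  proof -
    have "norm (b i) = 1" using *(1) i by (auto simp: orthonormal_frame_def norm_eq_1)
    obtain x y where xy: "x \<in> K" "y \<in> K" "width K (b i) = b i \<bullet> x - b i \<bullet> y"
      by (rule width_attained[OF K'(1) Kne, of "b i"])
    have "\<bar>(x - a) \<bullet> b i\<bar> \<le> r i" "\<bar>(y - a) \<bullet> b i\<bar> \<le> r i"
      using *(2) xy i unfolding A_def frame_box_def by blast+
    then show ?thesis using w[OF \<open>norm (b i) = 1\<close>] xy(3)
      unfolding inner_diff_left inner_commute[of "b i"] by linarith
  qed
  have "cball (a + g) (?c * w / 2) \<subseteq> K"
  proof
    fix y assume "y \<in> cball (a + g) (?c * w / 2)"
    then have y: "norm (y - (a + g)) \<le> ?c * w / 2" by (simp add: dist_norm norm_minus_commute)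
    have "y - (a + g) \<in> frame_box b (\<lambda>i. ?c * r i)"
      unfolding frame_box_def
    proof clarify
      fix i :: 'a assume i: "i \<in> Basis"
      have "norm (b i) = 1" using *(1) i by (auto simp: orthonormal_frame_def norm_eq_1)
      then have "\<bar>(y - (a + g)) \<bullet> b i\<bar> \<le> norm (y - (a + g))"
        using Cauchy_Schwarz_ineq2[of "y - (a + g)" "b i"] by simp
      also have "\<dots> \<le> ?c * (w / 2)" using y by simp
      also have "\<dots> \<le> ?c * r i" using r[OF i] c by (intro mult_left_mono) auto
      finally show "\<bar>(y - (a + g)) \<bullet> b i\<bar> \<le> ?c * r i" .
    qed
    from *(3)[OF this] have "y - a \<in> A" by (simp add: algebra_simps)
    then show "y \<in> K" by (auto simp: A_def)
  qed
  then show ?thesis by blast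
qed

section \<open>Polyhedra and support functions\<close>

text \<open>A smallest subfamily with the same intersection contains no redundant half-space, and
  then every facet lies on the bounding hyperplane of one of its members.\<close>

lemma facets_of_halfspace_intersection:
  fixes P :: "'a::euclidean_space set"
  assumes "finite H" and H: "\<And>h. h \<in> H \<Longrightarrow> \<exists>a b. a \<noteq> 0 \<and> h = {x. a \<bullet> x \<le> b}"
    and P: "P = \<Inter>H" "interior P \<noteq> {}"
  shows "polyhedron P" "card {F. F facet_of P} \<le> card H"
proof -
  obtain a b where ab: "\<And>h. h \<in> H \<Longrightarrow> a h \<noteq> 0 \<and> h = {x. a h \<bullet> x \<le> b h}"
    using H by metis
  show "polyhedron P" unfolding P(1)
    using \<open>finite H\<close> H by (intro polyhedron_Inter) (auto intro: polyhedron_halfspace_le)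
  define Q where "Q F \<longleftrightarrow> F \<subseteq> H \<and> P = \<Inter>F" for F
  have "Q H" using P by (simp add: Q_def)
  then obtain F where F: "Q F" and min: "\<And>G. Q G \<Longrightarrow> card F \<le> card G"
    using ex_has_least_nat[of Q H card] by blast
  have finF: "finite F" "F \<subseteq> H" "P = \<Inter>F" using F \<open>finite H\<close> by (auto simp: Q_def intro: finite_subset)
  have aff: "affine hull P = UNIV" using P(2) by (rule affine_hull_nonempty_interior)
  have "P \<subset> affine hull P \<inter> \<Inter>F'" if "F' \<subset> F" for F'
  proof -
    have "P \<subseteq> \<Inter>F'" using finF that by auto
    moreover have "P \<noteq> \<Inter>F'"
      using min[of F'] psubset_card_mono[OF finF(1) that] that finF by (auto simp: Q_def)
    ultimately show ?thesis using aff by auto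
  qed
  note psub = this
  have seq: "P = affine hull P \<inter> \<Inter>F" using aff finF(3) by simp
  have abF: "a h \<noteq> 0 \<and> h = {x. a h \<bullet> x \<le> b h}" if "h \<in> F" for h
    using ab finF(2) that by blast
  have "C facet_of P \<longleftrightarrow> (\<exists>h. h \<in> F \<and> C = P \<inter> {x. a h \<bullet> x = b h})" for C
    by (rule facet_of_polyhedron_explicit[OF finF(1) seq abF psub])
  then have "{C. C facet_of P} = (\<lambda>h. P \<inter> {x. a h \<bullet> x = b h}) ` F" by auto
  then have "card {C. C facet_of P} \<le> card F" using card_image_le[OF finF(1)] by simp
  also have "\<dots> \<le> card H" using finF \<open>finite H\<close> by (intro card_mono)
  finally show "card {F. F facet_of P} \<le> card H" .
qed

text \<open>A supremum of linear functions is convex, and a finite convex function on the whole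
  space is continuous.\<close>

lemma continuous_on_support_function:
  fixes K :: "'a::euclidean_space set"
  assumes "compact K" "K \<noteq> {}"
  shows "continuous_on UNIV (\<lambda>v. SUP y\<in>K. v \<bullet> y)"
proof (rule convex_on_continuous)
  have bdd: "bdd_above ((\<lambda>y. v \<bullet> y) ` K)" for v
    using assms by (intro bounded_imp_bdd_above compact_imp_bounded compact_continuous_image continuous_intros)
  show "convex_on UNIV (\<lambda>v. SUP y\<in>K. v \<bullet> y)"
  proof (rule convex_onI)
    fix t :: real and v w :: 'a assume t: "0 < t" "t < 1"
    show "(SUP y\<in>K. ((1 - t) *\<^sub>R v + t *\<^sub>R w) \<bullet> y) \<le> (1 - t) * (SUP y\<in>K. v \<bullet> y) + t * (SUP y\<in>K. w \<bullet> y)"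
    proof (rule cSUP_least[OF assms(2)])
      fix y assume "y \<in> K"
      then have "v \<bullet> y \<le> (SUP y\<in>K. v \<bullet> y)" "w \<bullet> y \<le> (SUP y\<in>K. w \<bullet> y)"
        by (auto intro: cSUP_upper bdd)
      then show "((1 - t) *\<^sub>R v + t *\<^sub>R w) \<bullet> y \<le> (1 - t) * (SUP y\<in>K. v \<bullet> y) + t * (SUP y\<in>K. w \<bullet> y)"
        using t by (auto simp: inner_add_left intro!: add_mono mult_left_mono)
    qed
  qed auto
qed auto

section \<open>Caps and dual caps of the fattened body\<close>

text \<open>The condition \<open>16 * \<delta> \<le> \<epsilon>\<close> leaves room in the estimates
  for half-spaces. The last condition says that the loss in \<open>primal_conflict_separates\<close>
  stays below the gain \<open>\<epsilon> / 2\<close>.\<close>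

locale offset_body =
  fixes K :: "'a::euclidean_space set" and \<delta> \<epsilon> :: real
  assumes compact: "compact K" and convex: "convex K"
    and \<delta>: "\<delta> > 0" "16 * \<delta> \<le> \<epsilon>" "(2 + 10 / box_ratio DIM('a)) * \<delta> < \<epsilon> / 2"
begin

definition Kd :: "'a set" where "Kd = {x + y | x y. x \<in> K \<and> y \<in> cball 0 \<delta>}"

definition contact :: "'a \<Rightarrow> 'a \<Rightarrow> bool" where
  "contact k u \<longleftrightarrow> k \<in> K \<and> norm u = 1 \<and> (\<forall>y\<in>K. u \<bullet> y \<le> u \<bullet> k)"

text \<open>The cap is the part of \<open>Kd\<close> beyond the supporting hyperplane of
  \<open>K\<close> at \<open>k\<close>. It is enclosed in a box centred at \<open>k\<close> and
  contains a parallel, proportional box centred at \<open>k + g\<close>.\<close>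

definition cap_frame :: "'a \<Rightarrow> 'a \<Rightarrow> ('a \<Rightarrow> 'a) \<Rightarrow> ('a \<Rightarrow> real) \<Rightarrow> 'a \<Rightarrow> bool" where
  "cap_frame k u b r g \<longleftrightarrow> orthonormal_frame b \<and> (\<forall>i\<in>Basis. \<delta> \<le> r i) \<and> g \<in> frame_box b r \<and>
     (\<forall>y\<in>Kd. u \<bullet> k \<le> u \<bullet> y \<longrightarrow> y - k \<in> frame_box b r) \<and>
     (\<forall>z\<in>frame_box b (\<lambda>i. box_ratio DIM('a) * r i). k + g + z \<in> Kd \<and> u \<bullet> k \<le> u \<bullet> (k + g + z))"

lemma compact_Kd: "compact Kd"
  unfolding Kd_def by (rule compact_sums[OF compact compact_cball])

lemma convex_Kd: "convex Kd"
proof -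
  have "Kd = (\<Union>x\<in>K. \<Union>y\<in>cball 0 \<delta>. {x + y})" unfolding Kd_def by blast
  then show ?thesis using convex_sums[OF convex convex_cball] by simp
qed

lemma K_subset_Kd: "K \<subseteq> Kd"
proof
  fix x assume "x \<in> K"
  then have "x + 0 \<in> Kd" using \<delta> unfolding Kd_def by fastforce
  then show "x \<in> Kd" by simp
qed

lemma cball_subset_Kd: "k \<in> K \<Longrightarrow> norm y \<le> \<delta> \<Longrightarrow> k + y \<in> Kd"
  unfolding Kd_def by fastforce

lemma contact_Kd: "contact k u \<Longrightarrow> y \<in> Kd \<Longrightarrow> u \<bullet> y \<le> u \<bullet> k + \<delta>"
proof -
  assume c: "contact k u" and "y \<in> Kd"
  then obtain x z where y: "y = x + z" "x \<in> K" "norm z \<le> \<delta>" by (auto simp: Kd_def)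
  have "u \<bullet> z \<le> norm u * norm z" by (rule norm_cauchy_schwarz)
  then show ?thesis using y c by (auto simp: contact_def inner_add_right)
qed

text \<open>The cap, moved to the origin, contains a half-ball of radius \<delta>. This gives it
  interior points, and since it contains \<delta> times \<open>b i\<close> or its negative, every
  \<open>r i\<close> is at least \<delta>.\<close>

lemma ex_cap_frame:
  assumes "contact k u"
  shows "\<exists>b r g. cap_frame k u b r g"
proof -
  have u: "norm u = 1" and k: "k \<in> K" using assms by (auto simp: contact_def)
  define A where "A = (\<lambda>y. y - k) ` (Kd \<inter> {y. u \<bullet> k \<le> u \<bullet> y})"
  have A_iff: "z \<in> A \<longleftrightarrow> k + z \<in> Kd \<and> 0 \<le> u \<bullet> z" for z
    unfolding A_def by (force simp: inner_add_right inner_diff_right image_iff)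
  have cl: "closed {y. u \<bullet> k \<le> u \<bullet> y}" by (intro closed_Collect_le continuous_intros)
  have cv: "convex {y. u \<bullet> k \<le> u \<bullet> y}" using convex_halfspace_ge[of "u \<bullet> k" u] by simp
  have A1: "compact A" unfolding A_def
    by (intro compact_continuous_image continuous_intros compact_Int_closed compact_Kd cl)
  have A2: "convex A" unfolding A_def using convex_Int[OF convex_Kd cv]
    by (simp add: convex_translation_subtract)
  have A3: "z \<in> A" if "norm z \<le> \<delta>" "0 \<le> u \<bullet> z" for z
    using that cball_subset_Kd[OF k] by (simp add: A_iff)
  have A4: "interior A \<noteq> {}"
  proof -
    have "ball ((\<delta>/2) *\<^sub>R u) (\<delta>/2) \<subseteq> A"
    proof
      fix z assume "z \<in> ball ((\<delta>/2) *\<^sub>R u) (\<delta>/2)"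
      then have z: "norm (z - (\<delta>/2) *\<^sub>R u) < \<delta>/2" by (simp add: dist_norm norm_minus_commute)
      have "norm z \<le> norm (z - (\<delta>/2) *\<^sub>R u) + norm ((\<delta>/2) *\<^sub>R u)" by (metis diff_add_cancel norm_triangle_ineq)
      then have "norm z \<le> \<delta>" using z u \<delta> by simp
      moreover have "\<bar>u \<bullet> (z - (\<delta>/2) *\<^sub>R u)\<bar> \<le> norm u * norm (z - (\<delta>/2) *\<^sub>R u)"
        by (rule Cauchy_Schwarz_ineq2)
      then have "0 \<le> u \<bullet> z" using z u by (simp add: inner_diff_right norm_eq_1)
      ultimately show "z \<in> A" by (rule A3)
    qed
    then have "ball ((\<delta>/2) *\<^sub>R u) (\<delta>/2) \<subseteq> interior A" by (simp add: interior_maximal)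
    then show ?thesis using \<delta> by auto
  qed
  have "0 \<in> A" using A3[of 0] \<delta> by simp
  then obtain b r g where *: "orthonormal_frame b" "\<And>i. i \<in> Basis \<Longrightarrow> r i > 0" "A \<subseteq> frame_box b r" "g \<in> A"
    "\<And>z. z \<in> frame_box b (\<lambda>i. box_ratio DIM('a) * r i) \<Longrightarrow> g + z \<in> A"
    using convex_body_frame_box[OF A1 A2 _ A4] by metis
  have "\<delta> \<le> r i" if i: "i \<in> Basis" for i
  proof -
    define s :: real where "s = (if 0 \<le> u \<bullet> b i then \<delta> else - \<delta>)"
    have bi: "b i \<bullet> b i = 1" using *(1) i by (simp add: orthonormal_frame_def)
    have "s *\<^sub>R b i \<in> A" using \<delta> bi
      by (intro A3) (auto simp: s_def norm_eq_sqrt_inner mult_nonneg_nonneg mult_nonneg_nonpos intro: mult_nonpos_nonpos)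
    then have "\<bar>(s *\<^sub>R b i) \<bullet> b i\<bar> \<le> r i" using *(3) i by (auto simp: frame_box_def)
    then show ?thesis using bi \<delta> by (auto simp: s_def split: if_splits)
  qed
  moreover have "y - k \<in> frame_box b r" if "y \<in> Kd" "u \<bullet> k \<le> u \<bullet> y" for y
    using that *(3) A_iff[of "y - k"] by (auto simp: inner_diff_right)
  moreover have "k + g + z \<in> Kd \<and> u \<bullet> k \<le> u \<bullet> (k + g + z)"
    if "z \<in> frame_box b (\<lambda>i. box_ratio DIM('a) * r i)" for z
    using *(5)[OF that] A_iff[of "g + z"] by (simp add: add.assoc inner_add_right)
  ultimately have "cap_frame k u b r g"
    using * unfolding cap_frame_def by blast
  then show ?thesis by blast
qed

lemma cap_frame_symmetric_part:
  assumes "cap_frame k u b r g" "z \<in> frame_box b (\<lambda>i. box_ratio DIM('a) * r i)"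
  shows "z \<in> symmetric_part Kd (k + g)"
  using assms uminus_frame_box[of z b] unfolding cap_frame_def symmetric_part_def
  by (metis (no_types, lifting) mem_Collect_eq uminus_add_conv_diff add.commute)

lemma zero_in_cap_box:
  assumes "cap_frame k u b r g"
  shows "0 \<in> frame_box b (\<lambda>i. box_ratio DIM('a) * r i)"
  using assms box_ratio_pos[of "DIM('a)"] \<delta>(1) by (force simp: frame_box_def cap_frame_def intro!: mult_nonneg_nonneg)

text \<open>As the shrunk regions meet, the expansion lemma puts the shrunk inner box of the first
  cap into the Macbeath region at \<open>k' + g'\<close>, where the values of \<open>u'\<close> stay
  within \<delta> of \<open>u' \<bullet> k'\<close>. This forces \<open>k\<close> to lie at most
  \<open>(1 + 10 / ?c) * \<delta>\<close> below the hyperplane at \<open>k'\<close>, and the step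
  \<epsilon> along \<open>u\<close> gains at least \<open>\<epsilon> / 2\<close>.\<close>

lemma primal_conflict_separates:
  assumes c: "contact k u" "contact k' u'"
    and f: "cap_frame k u b r g" "cap_frame k' u' b' r' g'"
    and a: "a \<in> frame_box b (\<lambda>i. box_ratio DIM('a) * r i)" "a' \<in> frame_box b' (\<lambda>i. box_ratio DIM('a) * r' i)"
    and eq: "k' + g' + a' /\<^sub>R 5 = k + g + a /\<^sub>R 5" and uu: "1/2 \<le> u' \<bullet> u"
  shows "u' \<bullet> k' + \<delta> < u' \<bullet> (k + \<epsilon> *\<^sub>R u)"
proof -
  let ?c = "box_ratio DIM('a)"
  have cpos: "?c > 0" by (simp add: box_ratio_pos)
  \<comment> \<open>The reflection of this point in \<open>k' + g'\<close> is also in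
    \<open>Kd\<close>, so its value is at most \<open>u' \<bullet> k' + \<delta>\<close>, while the
    centre has value at least \<open>u' \<bullet> k'\<close>.\<close>
  have key: "u' \<bullet> k' - \<delta> \<le> u' \<bullet> (k + g + w /\<^sub>R 5)" if w: "w \<in> frame_box b (\<lambda>i. ?c * r i)" for w
  proof -
    have "(a' - a + w) /\<^sub>R 5 \<in> symmetric_part Kd (k' + g')"
      by (rule macbeath_expansion[OF convex_Kd cap_frame_symmetric_part[OF f(2) a(2)]
            cap_frame_symmetric_part[OF f(1) a(1)] cap_frame_symmetric_part[OF f(1) w] eq])
    then have "k' + g' - (a' - a + w) /\<^sub>R 5 \<in> Kd" by (simp add: symmetric_part_def)
    from contact_Kd[OF c(2) this]
    have "u' \<bullet> (k' + g') - u' \<bullet> ((a' - a + w) /\<^sub>R 5) \<le> u' \<bullet> k' + \<delta>" by (simp add: inner_diff_right)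
    moreover have "u' \<bullet> k' \<le> u' \<bullet> (k' + g')"
      using f(2) zero_in_cap_box[OF f(2)] unfolding cap_frame_def by (metis add_0_right)
    moreover have "k + g + w /\<^sub>R 5 = k' + g' + (a' - a + w) /\<^sub>R 5"
      using eq by (simp add: algebra_simps)
    ultimately show ?thesis by (simp add: inner_add_right)
  qed
  have up: "u' \<bullet> (k + g) \<le> u' \<bullet> k' + \<delta>"
    using f(1) zero_in_cap_box[OF f(1)] unfolding cap_frame_def
    by (metis add_0_right contact_Kd[OF c(2)])
  have low: "u' \<bullet> k' - \<delta> \<le> u' \<bullet> (k + g)"
    using key[OF zero_in_cap_box[OF f(1)]] by simp
  \<comment> \<open>Since \<open>g\<close> lies in the outer box, this multiple of it lies in the
    inner one. Moving from the centre in this direction bounds \<open>u' \<bullet> g\<close>, which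
    carries the estimate from \<open>k + g\<close> back to \<open>k\<close>.\<close>
  have "- (?c *\<^sub>R g) \<in> frame_box b (\<lambda>i. ?c * r i)"
    using f(1) cpos by (simp add: uminus_frame_box scale_frame_box cap_frame_def)
  from key[OF this] have "u' \<bullet> k' - \<delta> \<le> u' \<bullet> (k + g) - ?c * (u' \<bullet> g) / 5"
    by (simp add: inner_add_right inner_diff_right)
  with up have "?c * (u' \<bullet> g) \<le> 10 * \<delta>" by simp
  then have "u' \<bullet> g \<le> 10 / ?c * \<delta>" using cpos by (simp add: field_simps)
  with low have "u' \<bullet> k' - \<delta> - 10 / ?c * \<delta> \<le> u' \<bullet> k" by (simp add: inner_add_right)
  moreover have "\<epsilon> * (1/2) \<le> \<epsilon> * (u' \<bullet> u)" using uu \<delta> by (intro mult_left_mono) auto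
  moreover have "2 * \<delta> + 10 / ?c * \<delta> < \<epsilon> / 2" using \<delta>(3) by (simp only: distrib_right)
  moreover have "u' \<bullet> (k + \<epsilon> *\<^sub>R u) = u' \<bullet> k + \<epsilon> * (u' \<bullet> u)" by (simp add: inner_add_right)
  ultimately show ?thesis by linarith
qed

text \<open>A pair stands for the half-space of all \<open>y\<close> with
  \<open>v \<bullet> y \<le> s\<close>. The set is the epigraph of the support function of
  \<open>Kd\<close> over the unit ball; admitting \<open>v = 0\<close> keeps it convex.\<close>

definition dual_body :: "('a \<times> real) set" where
  "dual_body = {(v, s). norm v \<le> 1 \<and> (\<forall>y\<in>Kd. v \<bullet> y \<le> s)}"

text \<open>On \<open>dual_body\<close> the height \<open>p \<bullet> v - s\<close> of a pair \<open>(v, s)\<close> over the point \<open>p = k + \<epsilon>u\<close> is at most \<open>\<epsilon>\<close>.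
  The centre has height \<open>9/16 * \<epsilon> > \<epsilon>/2\<close>, so by symmetry every pair of its Macbeath region has
  positive height, i.e. separates \<open>p\<close>; the constants leave room for a slab of thickness \<open>\<epsilon>/8\<close>.\<close>

definition dual_centre :: "'a \<Rightarrow> 'a \<Rightarrow> 'a \<times> real" where
  "dual_centre k u = ((3/4) *\<^sub>R u, (k + \<epsilon> *\<^sub>R u) \<bullet> ((3/4) *\<^sub>R u) - 9/16 * \<epsilon>)"

text \<open>The base is dual to the box of the cap: its vectors have products at most
  \<open>\<delta> / 64\<close> with the points of that box. Over the base, \<open>s\<close> differs
  from the value of \<open>v\<close> at \<open>k + \<epsilon> u\<close> by at most
  \<open>\<epsilon> / 16\<close>; lower bound plus thickness is the form that
  \<open>measure_graph_slab\<close> measures.\<close>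

definition dual_slab :: "'a \<Rightarrow> 'a \<Rightarrow> ('a \<Rightarrow> 'a) \<Rightarrow> ('a \<Rightarrow> real) \<Rightarrow> ('a \<times> real) set" where
  "dual_slab k u b r = {(v, s). v \<in> frame_box b (\<lambda>i. \<delta> / (64 * real DIM('a) * r i)) \<and>
      (k + \<epsilon> *\<^sub>R u) \<bullet> v - \<epsilon>/16 \<le> s \<and> s \<le> (k + \<epsilon> *\<^sub>R u) \<bullet> v - \<epsilon>/16 + \<epsilon>/8}"

lemma convex_dual_body: "convex dual_body"
proof (rule convexI)
  fix x y :: "'a \<times> real" and p q :: real
  assume x: "x \<in> dual_body" and y: "y \<in> dual_body" and pq: "0 \<le> p" "0 \<le> q" "p + q = 1"
  have "norm (p *\<^sub>R fst x + q *\<^sub>R fst y) \<le> p * norm (fst x) + q * norm (fst y)"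
    using pq norm_triangle_ineq[of "p *\<^sub>R fst x" "q *\<^sub>R fst y"] by simp
  also have "\<dots> \<le> p * 1 + q * 1"
    using x y pq by (intro add_mono mult_left_mono) (auto simp: dual_body_def)
  finally have "norm (p *\<^sub>R fst x + q *\<^sub>R fst y) \<le> 1" using pq by simp
  moreover have "(p *\<^sub>R fst x + q *\<^sub>R fst y) \<bullet> z \<le> p * snd x + q * snd y" if "z \<in> Kd" for z
    using x y pq that by (auto simp: inner_add_left dual_body_def intro!: add_mono mult_left_mono)
  ultimately show "p *\<^sub>R x + q *\<^sub>R y \<in> dual_body"
    by (auto simp: dual_body_def case_prod_beta)
qed

text \<open>The value \<open>v \<bullet> k\<close> is at most \<open>s\<close>, and the step
  \<epsilon> along \<open>u\<close> adds at most \<epsilon> because \<open>v\<close> has norm at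
  most 1.\<close>

lemma dual_body_height:
  assumes c: "contact k u" and vs: "(v, s) \<in> dual_body"
  shows "(k + \<epsilon> *\<^sub>R u) \<bullet> v - s \<le> \<epsilon>"
proof -
  have "v \<bullet> k \<le> s" "norm v \<le> 1" using vs c K_subset_Kd by (auto simp: dual_body_def contact_def)
  moreover have "u \<bullet> v \<le> norm u * norm v" by (rule norm_cauchy_schwarz)
  then have "u \<bullet> v \<le> 1" using c \<open>norm v \<le> 1\<close> by (auto simp: contact_def)
  then have "\<epsilon> * (u \<bullet> v) \<le> \<epsilon> * 1" using \<delta> by (intro mult_left_mono) auto
  ultimately show ?thesis by (simp add: inner_add_left inner_add_right inner_commute)
qed

lemma symmetric_part_dual_body:
  assumes c: "contact k u" and w: "w \<in> symmetric_part dual_body (dual_centre k u)"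
  shows "dual_centre k u + w \<in> dual_body"
    and "snd (dual_centre k u + w) < (k + \<epsilon> *\<^sub>R u) \<bullet> fst (dual_centre k u + w)"
proof -
  let ?z = "dual_centre k u"
  have L: "?z + w \<in> dual_body" "?z - w \<in> dual_body" using w by (auto simp: symmetric_part_def)
  then show "?z + w \<in> dual_body" by simp
  have "(k + \<epsilon> *\<^sub>R u) \<bullet> fst (?z - w) - snd (?z - w) \<le> \<epsilon>"
    using dual_body_height[OF c, of "fst (?z - w)" "snd (?z - w)"] L(2) by (simp only: prod.collapse)
  then show "snd (?z + w) < (k + \<epsilon> *\<^sub>R u) \<bullet> fst (?z + w)"
    using \<delta> by (simp add: dual_centre_def inner_diff_right inner_add_right)
qed

text \<open>The slab is symmetric about 0, so it suffices that the centre plus a slab element lies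
  in \<open>dual_body\<close>. For points of \<open>Kd\<close> in the cap this is the duality of the
  boxes; points below the hyperplane are compared with the cap along a segment from
  \<open>k + \<delta> u\<close>.\<close>

lemma dual_slab_symmetric_part:
  assumes c: "contact k u" and f: "cap_frame k u b r g" and w: "w \<in> dual_slab k u b r"
  shows "w \<in> symmetric_part dual_body (dual_centre k u)"
proof -
  let ?p = "k + \<epsilon> *\<^sub>R u"
  have u: "norm u = 1" "u \<bullet> u = 1" and k: "k \<in> K" using c by (auto simp: contact_def norm_eq_1)
  have fr: "orthonormal_frame b" and r: "\<And>i. i \<in> Basis \<Longrightarrow> \<delta> \<le> r i"
    and cap: "\<And>y. y \<in> Kd \<Longrightarrow> u \<bullet> k \<le> u \<bullet> y \<Longrightarrow> y - k \<in> frame_box b r"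
    using f by (auto simp: cap_frame_def)
  have main: "dual_centre k u + (v, s) \<in> dual_body" if "(v, s) \<in> dual_slab k u b r" for v s
  proof -
    have v: "\<bar>v \<bullet> b i\<bar> \<le> \<delta> / (64 * real DIM('a) * r i)" if "i \<in> Basis" for i
      using \<open>(v, s) \<in> dual_slab k u b r\<close> that by (auto simp: dual_slab_def frame_box_def)
    have vy: "\<bar>v \<bullet> y\<bar> \<le> \<delta> / 64" if "y \<in> frame_box b r" for y
    proof -
      have "\<bar>v \<bullet> y\<bar> \<le> (\<Sum>i\<in>Basis. \<bar>(v \<bullet> b i) * (y \<bullet> b i)\<bar>)"
        unfolding orthonormal_frame_inner[OF fr, of v y] by (rule sum_abs)
      also have "\<dots> \<le> (\<Sum>i\<in>(Basis::'a set). \<delta> / (64 * real DIM('a)))"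
      proof (rule sum_mono)
        fix i :: 'a assume i: "i \<in> Basis"
        then have "r i > 0" using r \<delta> by fastforce
        have "\<bar>v \<bullet> b i\<bar> * \<bar>y \<bullet> b i\<bar> \<le> \<delta> / (64 * real DIM('a) * r i) * r i"
          using v[OF i] that i \<open>r i > 0\<close> \<delta> by (intro mult_mono) (auto simp: frame_box_def)
        then show "\<bar>(v \<bullet> b i) * (y \<bullet> b i)\<bar> \<le> \<delta> / (64 * real DIM('a))"
          using \<open>r i > 0\<close> by (simp add: abs_mult)
      qed
      also have "\<dots> = \<delta> / 64" by simp
      finally show ?thesis .
    qed
    have nv: "norm v \<le> 1/64"
    proof -
      have "norm v \<le> (\<Sum>i\<in>Basis. \<bar>v \<bullet> b i\<bar>)" by (rule norm_le_orthonormal_frame[OF fr])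
      also have "\<dots> \<le> (\<Sum>i\<in>(Basis::'a set). 1 / (64 * real DIM('a)))"
      proof (rule sum_mono)
        fix i :: 'a assume i: "i \<in> Basis"
        then have "\<delta> \<le> r i" "r i > 0" using r[OF i] \<delta> by linarith+
        then have "\<delta> / (64 * real DIM('a) * r i) \<le> 1 / (64 * real DIM('a))"
          by (simp add: field_simps)
        then show "\<bar>v \<bullet> b i\<bar> \<le> 1 / (64 * real DIM('a))" using v[OF i] by linarith
      qed
      also have "\<dots> = 1/64" by simp
      finally show ?thesis .
    qed
    have vu: "\<bar>v \<bullet> u\<bar> \<le> 1/64" using Cauchy_Schwarz_ineq2[of v u] nv u by simp
    have evu: "\<bar>\<epsilon> * (v \<bullet> u)\<bar> \<le> \<epsilon> / 64"
      using mult_left_mono[OF vu, of \<epsilon>] \<delta> by (simp add: abs_mult)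
    have n1: "norm ((3/4) *\<^sub>R u + v) \<le> 1"
      using norm_triangle_ineq[of "(3/4) *\<^sub>R u" v] u nv by simp
    have ex: "((3/4) *\<^sub>R u + v) \<bullet> y = 3/4 * (u \<bullet> y) + v \<bullet> y"
      "?p \<bullet> ((3/4) *\<^sub>R u + v) = 3/4 * (u \<bullet> k) + 3/4 * \<epsilon> + v \<bullet> k + \<epsilon> * (v \<bullet> u)" for y
      using u by (simp_all add: inner_add_left inner_add_right inner_commute[of k] inner_commute[of u v])
    \<comment> \<open>The \<open>5/8\<close> is the \<open>9/16\<close> of the centre plus the
      \<open>1/16\<close> of the slab.\<close>
    have "((3/4) *\<^sub>R u + v) \<bullet> y \<le> ?p \<bullet> ((3/4) *\<^sub>R u + v) - 5/8 * \<epsilon>" if y: "y \<in> Kd" for y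
    proof (cases "u \<bullet> k \<le> u \<bullet> y")
      case True
      have "\<bar>v \<bullet> (y - k)\<bar> \<le> \<delta>/64" by (rule vy[OF cap[OF y True]])
      moreover have "u \<bullet> y \<le> u \<bullet> k + \<delta>" by (rule contact_Kd[OF c y])
      ultimately have "v \<bullet> y - v \<bullet> k \<le> \<delta>/64" "u \<bullet> y - u \<bullet> k \<le> \<delta>" "- (\<epsilon>/64) \<le> \<epsilon> * (v \<bullet> u)"
        using evu unfolding inner_diff_right by linarith+
      then show ?thesis using \<delta>(1,2) ex(1)[of y] ex(2) by linarith
    next
      case False
      define \<tau> where "\<tau> = u \<bullet> k - u \<bullet> y"
      have \<tau>: "\<tau> > 0" using False by (simp add: \<tau>_def)
      define x where "x = k + \<delta> *\<^sub>R u"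
      have xK: "x \<in> Kd" unfolding x_def using cball_subset_Kd[OF k, of "\<delta> *\<^sub>R u"] u \<delta> by simp
      have vx: "\<bar>v \<bullet> (x - k)\<bar> \<le> \<delta>/64"
        using \<delta> u by (intro vy cap xK) (simp add: x_def inner_add_right)
      \<comment> \<open>This choice puts the point \<open>y'\<close> of the segment from
        \<open>x\<close> to \<open>y\<close> on the hyperplane, hence into the cap. From
        \<open>x\<close> to \<open>y'\<close> the value of \<open>v\<close> grows by at most
        \<open>\<delta> / 32\<close>, so up to \<open>y\<close> by at most
        \<open>(\<delta> + \<tau>) / 32\<close>, which the descent \<open>3/4 * \<tau>\<close> of
        the main term outweighs.\<close>
      define \<theta> where "\<theta> = \<delta> / (\<delta> + \<tau>)"
      have \<theta>: "0 < \<theta>" "\<theta> \<le> 1" using \<delta> \<tau> by (auto simp: \<theta>_def)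
      define y' where "y' = (1 - \<theta>) *\<^sub>R x + \<theta> *\<^sub>R y"
      have "y' \<in> Kd" unfolding y'_def using \<theta> by (intro convexD[OF convex_Kd xK y]) auto
      moreover have "u \<bullet> y' = u \<bullet> k"
      proof -
        have "u \<bullet> y' = u \<bullet> k + \<delta> - \<theta> * (\<delta> + \<tau>)"
          using u by (simp add: y'_def x_def inner_add_right \<tau>_def algebra_simps)
        then show ?thesis using \<delta> \<tau> by (simp add: \<theta>_def)
      qed
      ultimately have vy': "\<bar>v \<bullet> (y' - k)\<bar> \<le> \<delta>/64" by (intro vy cap) auto
      have "v \<bullet> (y' - k) - v \<bullet> (x - k) = \<theta> * (v \<bullet> (y - x))"
        by (simp add: y'_def algebra_simps inner_add_right inner_diff_right)
      with vx vy' have "\<theta> * (v \<bullet> (y - x)) \<le> \<delta>/32" by linarith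
      then have "v \<bullet> (y - x) \<le> (\<delta> + \<tau>) / 32"
      proof -
        have "\<delta> * (v \<bullet> (y - x)) \<le> \<delta> * ((\<delta> + \<tau>) / 32)"
          using \<open>\<theta> * (v \<bullet> (y - x)) \<le> \<delta>/32\<close> \<delta>(1) \<tau> by (simp add: \<theta>_def field_simps)
        then show ?thesis using \<delta>(1) by (simp only: mult_le_cancel_left_pos)
      qed
      then have "v \<bullet> y - v \<bullet> k \<le> (\<delta> + \<tau>)/32 + \<delta>/64"
        using vx unfolding inner_diff_right by linarith
      moreover have "- (\<epsilon>/64) \<le> \<epsilon> * (v \<bullet> u)" using evu by linarith
      ultimately show ?thesis using \<delta>(1,2) \<tau> ex(1)[of y] ex(2) unfolding \<tau>_def by argo
    qed
    with n1 show ?thesis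
      using \<open>(v, s) \<in> dual_slab k u b r\<close>
      by (force simp: dual_body_def dual_centre_def dual_slab_def inner_add_right)
  qed
  obtain v s where vs: "w = (v, s)" by (cases w)
  have "(- v, - s) \<in> dual_slab k u b r"
    using w by (auto simp: vs dual_slab_def uminus_frame_box)
  from main[OF this] have "dual_centre k u - w \<in> dual_body" by (simp add: vs dual_centre_def)
  then show ?thesis using main[of v s] w by (simp add: symmetric_part_def vs)
qed

section \<open>Selecting finitely many separating half-spaces\<close>

definition framed :: "('a \<times> 'a) set \<Rightarrow> ('a \<times> 'a \<Rightarrow> 'a \<Rightarrow> 'a) \<Rightarrow> ('a \<times> 'a \<Rightarrow> 'a \<Rightarrow> real) \<Rightarrow> ('a \<times> 'a \<Rightarrow> 'a) \<Rightarrow> bool" where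
  "framed X b r g \<longleftrightarrow> (\<forall>t\<in>X. contact (fst t) (snd t) \<and> cap_frame (fst t) (snd t) (b t) (r t) (g t))"

text \<open>The inner boxes shrunk by 5 have volume at least \<open>m\<close> and lie in the shell.
  Two pairs conflict if their regions meet and their normals have inner product at least 1/2.
  Sorting the normals by the nearby point of \<open>Z\<close> makes the second condition automatic
  within a class, so there the regions of a conflict-free family are disjoint.\<close>

lemma primal_selection:
  assumes X: "framed X b r g" and R: "R > 0" "\<And>t. t \<in> X \<Longrightarrow> R \<le> (\<Prod>i\<in>Basis. r t i)"
    and Z: "finite Z" "sphere (0::'a) 1 \<subseteq> (\<Union>e\<in>Z. ball e (1/2))"
  obtains F where "finite F" "F \<subseteq> X"
    "real (card F) \<le> real (card Z) * (measure lebesgue (Kd - interior K) /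
        (unit_ball_vol (real DIM('a)) * (box_ratio DIM('a) / 20) ^ DIM('a) * R))"
    "\<And>k u. (k, u) \<in> X \<Longrightarrow> \<exists>(k', u')\<in>F. u' \<bullet> k' + \<delta> < u' \<bullet> (k + \<epsilon> *\<^sub>R u)"
proof -
  let ?n = "DIM('a)"
  let ?c = "box_ratio ?n"
  define box where "box t = frame_box (b t) (\<lambda>i. ?c * r t i)" for t
  define reg where "reg t = (\<lambda>z. (1/5) *\<^sub>R z + (fst t + g t)) ` box t" for t
  \<comment> \<open>The 20 combines the shrinking by 5 with the 4 per dimension in the volume bound
    for boxes.\<close>
  define m where "m = unit_ball_vol (real ?n) * (?c / 20) ^ ?n * R"
  have cpos: "?c > 0" by (simp add: box_ratio_pos)
  have m: "m > 0" unfolding m_def using cpos R by (intro mult_pos_pos unit_ball_vol_pos) auto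
  have fr: "contact (fst t) (snd t)" "cap_frame (fst t) (snd t) (b t) (r t) (g t)" "orthonormal_frame (b t)"
    "\<And>i. i \<in> Basis \<Longrightarrow> r t i > 0" if "t \<in> X" for t
    using X that \<delta>(1) unfolding framed_def cap_frame_def by fastforce+
  have T: "Kd - interior K \<in> lmeasurable"
    by (intro fmeasurable.Diff lmeasurable_compact[OF compact_Kd] fmeasurableD
        lmeasurable_interior compact_imp_bounded compact)
  have reg_meas: "reg t \<in> lmeasurable" if "t \<in> X" for t
    unfolding reg_def box_def
    by (intro lmeasurable_compact compact_continuous_image continuous_intros compact_frame_box fr that)
  have reg_ge: "m \<le> measure lebesgue (reg t)" if t: "t \<in> X" for t
  proof -
    have "unit_ball_vol (real ?n) / 4 ^ ?n * (\<Prod>i\<in>Basis. ?c * r t i) \<le> measure lebesgue (box t)"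
      unfolding box_def using fr[OF t] cpos by (intro measure_frame_box_ge) auto
    then have "(1/5) ^ ?n * (unit_ball_vol (real ?n) / 4 ^ ?n * (\<Prod>i\<in>Basis. ?c * r t i)) \<le> (1/5) ^ ?n * measure lebesgue (box t)"
      by (intro mult_left_mono) auto
    also have "\<dots> = measure lebesgue (reg t)"
      unfolding reg_def measure_lebesgue_affine by simp
    finally have "(1/5) ^ ?n * (unit_ball_vol (real ?n) / 4 ^ ?n * (\<Prod>i\<in>Basis. ?c * r t i)) \<le> measure lebesgue (reg t)" .
    moreover have "(1/5) ^ ?n * (unit_ball_vol (real ?n) / 4 ^ ?n * (\<Prod>i\<in>Basis. ?c * r t i))
       = unit_ball_vol (real ?n) * (?c / 20) ^ ?n * (\<Prod>i\<in>Basis. r t i)"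
    proof -
      have "(20::real) ^ ?n = 5 ^ ?n * 4 ^ ?n" by (simp flip: power_mult_distrib)
      then show ?thesis by (simp add: prod.distrib power_divide)
    qed
    moreover have "m \<le> unit_ball_vol (real ?n) * (?c / 20) ^ ?n * (\<Prod>i\<in>Basis. r t i)"
      unfolding m_def using R(2)[OF t] cpos by (intro mult_left_mono) auto
    ultimately show ?thesis by linarith
  qed
  have reg_sub: "reg t \<subseteq> Kd - interior K" if t: "t \<in> X" for t
  proof
    fix y assume "y \<in> reg t"
    then obtain z where z: "z \<in> box t" "y = (1/5) *\<^sub>R z + (fst t + g t)" by (auto simp: reg_def)
    define z' where "z' = (1/5) *\<^sub>R z"
    have "z' \<in> box t"
      using z(1) fr[OF t] cpos by (force simp: z'_def box_def frame_box_def)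
    then have y: "y \<in> Kd" "snd t \<bullet> fst t \<le> snd t \<bullet> y"
      using fr(2)[OF t] z(2) unfolding cap_frame_def box_def z'_def by (auto simp: add_ac)
    \<comment> \<open>A neighbourhood of \<open>y\<close> inside \<open>K\<close> would reach
      strictly beyond the supporting hyperplane.\<close>
    have "y \<notin> interior K"
    proof
      assume "y \<in> interior K"
      then obtain e where e: "e > 0" "cball y e \<subseteq> K" by (meson mem_interior_cball)
      have u: "norm (snd t) = 1" using fr(1)[OF t] by (simp add: contact_def)
      have "y + e *\<^sub>R snd t \<in> K" using e u by (intro subsetD[OF e(2)]) (simp add: dist_norm)
      then have "snd t \<bullet> (y + e *\<^sub>R snd t) \<le> snd t \<bullet> fst t" using fr(1)[OF t] by (simp add: contact_def)
      then show False using y(2) e(1) u by (simp add: inner_add_right norm_eq_1)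
    qed
    then show "y \<in> Kd - interior K" using y by simp
  qed
  define conf where "conf t t' \<longleftrightarrow> 1/2 \<le> snd t \<bullet> snd t' \<and> \<not> disjnt (reg t) (reg t')" for t t'
  have conf_sym: "conf t t' \<longleftrightarrow> conf t' t" for t t' by (auto simp: conf_def inner_commute disjnt_sym)
  obtain F where F: "finite F" "F \<subseteq> X" "real (card F) \<le> real (card Z) * (measure lebesgue (Kd - interior K) / m)"
    "\<And>t. t \<in> X \<Longrightarrow> \<exists>t'\<in>F. conf t t' \<or> conf t' t"
  proof (rule finite_maximal_selection[of X conf])
    show "conf t t" if "t \<in> X" for t
    proof -
      have "0 \<in> box t" unfolding box_def by (rule zero_in_cap_box[OF fr(2)[OF that]])
      then have "reg t \<noteq> {}" by (auto simp: reg_def)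
      then show ?thesis using fr(1)[OF that] by (simp add: conf_def contact_def norm_eq_1 disjnt_def)
    qed
    fix F assume F: "finite F" "F \<subseteq> X" "pairwise (\<lambda>x y. \<not> conf x y \<and> \<not> conf y x) F"
    define Fe where "Fe e = {t \<in> F. snd t \<in> ball e (1/2)}" for e
    have "card (Fe e) \<le> measure lebesgue (Kd - interior K) / m" for e
    proof -
      have "real (card (Fe e)) * m \<le> measure lebesgue (Kd - interior K)"
      proof (rule card_packing_le[of _ reg])
        show "pairwise (\<lambda>t t'. disjnt (reg t) (reg t')) (Fe e)"
        proof (rule pairwiseI)
          fix t t' assume t: "t \<in> Fe e" "t' \<in> Fe e" "t \<noteq> t'"
          have "dist (snd t) (snd t') < 1"
            using t dist_triangle_half_l[of "snd t" e 1 "snd t'"] by (simp add: Fe_def dist_commute)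
          then have "(norm (snd t - snd t'))\<^sup>2 < 1" by (simp add: dist_norm power_less_one_iff)
          moreover have "norm (snd t) = 1" "norm (snd t') = 1"
            using t F(2) fr(1)[of t] fr(1)[of t'] by (auto simp: Fe_def contact_def)
          ultimately have "1/2 \<le> snd t \<bullet> snd t'"
            by (simp add: power2_norm_eq_inner inner_diff_left inner_diff_right norm_eq_1 inner_commute)
          moreover have "\<not> conf t t'" using F(3) t by (auto simp: Fe_def pairwise_def)
          ultimately show "disjnt (reg t) (reg t')" by (simp add: conf_def)
        qed
        show "reg t \<in> lmeasurable" "reg t \<subseteq> Kd - interior K" "m \<le> measure lebesgue (reg t)" if "t \<in> Fe e" for t
          using that F(2) reg_meas[of t] reg_sub[of t] reg_ge[of t] unfolding Fe_def by blast+
      qed (use F T in \<open>auto simp: Fe_def\<close>)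
      then show ?thesis using m by (simp add: pos_le_divide_eq)
    qed
    note Fe = this
    have "F \<subseteq> (\<Union>e\<in>Z. Fe e)"
    proof
      fix t assume t: "t \<in> F"
      then have "snd t \<in> sphere 0 1" using F(2) fr(1)[of t] by (auto simp: contact_def)
      then obtain e where "e \<in> Z" "snd t \<in> ball e (1/2)" using Z(2) by blast
      then show "t \<in> (\<Union>e\<in>Z. Fe e)" using t by (auto simp: Fe_def)
    qed
    then have "card F \<le> card (\<Union>e\<in>Z. Fe e)"
      using Z(1) F(1) by (intro card_mono) (auto simp: Fe_def)
    also have "\<dots> \<le> (\<Sum>e\<in>Z. card (Fe e))" using Z(1) by (rule card_UN_le)
    finally have "real (card F) \<le> (\<Sum>e\<in>Z. real (card (Fe e)))" by (simp flip: of_nat_sum)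
    also have "\<dots> \<le> (\<Sum>e\<in>Z. measure lebesgue (Kd - interior K) / m)" by (intro sum_mono Fe)
    finally show "real (card F) \<le> real (card Z) * (measure lebesgue (Kd - interior K) / m)" by simp
  qed (rule that, assumption+)
  have sep: "\<exists>(k', u')\<in>F. u' \<bullet> k' + \<delta> < u' \<bullet> (k + \<epsilon> *\<^sub>R u)" if ku: "(k, u) \<in> X" for k u
  proof -
    obtain t' where t': "t' \<in> F" "conf t' (k, u)" using F(4)[OF ku] conf_sym by blast
    obtain k' u' where t'_eq: "t' = (k', u')" by (cases t')
    have X': "(k', u') \<in> X" using t' F(2) t'_eq by blast
    from t'(2) obtain a a' where aa: "a \<in> box (k, u)" "a' \<in> box (k', u')"
      "(1/5) *\<^sub>R a' + (k' + g (k', u')) = (1/5) *\<^sub>R a + (k + g (k, u))"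
      by (auto simp: conf_def t'_eq reg_def disjnt_def)
    have "u' \<bullet> k' + \<delta> < u' \<bullet> (k + \<epsilon> *\<^sub>R u)"
      using primal_conflict_separates[OF fr(1)[OF ku] fr(1)[OF X'] fr(2)[OF ku] fr(2)[OF X']] aa t'(2)
      by (auto simp: box_def conf_def t'_eq add_ac)
    then show ?thesis using t'(1) t'_eq by auto
  qed
  show ?thesis
  proof (rule that[of F])
    show "real (card F) \<le> real (card Z) * (measure lebesgue (Kd - interior K) /
        (unit_ball_vol (real ?n) * (?c / 20) ^ ?n * R))"
      using F(3) unfolding m_def .
    show "finite F" "F \<subseteq> X" by (rule F(1), rule F(2))
    show "\<exists>(k', u')\<in>F. u' \<bullet> k' + \<delta> < u' \<bullet> (k + \<epsilon> *\<^sub>R u)" if "(k, u) \<in> X" for k u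
      by (rule sep[OF that])
  qed
qed

text \<open>The slabs shrunk by 5 about the dual centres have volume at least \<open>m\<close> and
  lie in a layer of volume \<open>\<epsilon> * ?\<omega>\<close>. If two of them meet, the centre of
  one lies in the Macbeath region at the centre of the other, so its half-space separates the point
  belonging to the other.\<close>

lemma dual_selection:
  assumes X: "framed X b r g" and R: "\<And>t. t \<in> X \<Longrightarrow> (\<Prod>i\<in>Basis. r t i) \<le> R" "R > 0" and "K \<noteq> {}"
  obtains F where "finite F" "F \<subseteq> X"
    "real (card F) \<le> R * (40 * 5 ^ DIM('a) / (\<delta> / (256 * real DIM('a))) ^ DIM('a))"
    "\<And>k u. (k, u) \<in> X \<Longrightarrow> \<exists>(k', u')\<in>F. dual_centre k' u' \<in> dual_body \<and>
        snd (dual_centre k' u') < (k + \<epsilon> *\<^sub>R u) \<bullet> fst (dual_centre k' u')"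
proof -
  let ?n = "DIM('a)"
  let ?z = "\<lambda>t. dual_centre (fst t) (snd t)"
  let ?\<omega> = "unit_ball_vol (real ?n)"
  have \<omega>: "?\<omega> > 0" by (intro unit_ball_vol_pos) auto
  have \<epsilon>: "\<epsilon> > 0" using \<delta> by linarith
  define slab where "slab t = dual_slab (fst t) (snd t) (b t) (r t)" for t
  define reg where "reg t = (\<lambda>w. (1/5) *\<^sub>R w + ?z t) ` slab t" for t
  define H where "H v = (SUP y\<in>Kd. v \<bullet> y)" for v
  \<comment> \<open>Layer above the graph of the support function \<open>H\<close> of
    \<open>Kd\<close>: containing \<open>Kd\<close> means \<open>H v \<le> s\<close>, and separating
    a point at distance \<epsilon> from \<open>K\<close> forces \<open>s\<close> below
    \<open>H v + \<epsilon>\<close>.\<close>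
  define T where "T = {(v, s). v \<in> cball 0 1 \<and> H v \<le> s \<and> s \<le> H v + \<epsilon>}"
  define d where "d = (\<delta> / (256 * real ?n)) ^ ?n"
  have d: "d > 0" using \<delta> by (simp add: d_def)
  \<comment> \<open>The exponent is \<open>?n + 1\<close> because the pairs have one more
    coordinate; \<open>\<epsilon> / 8\<close> is the thickness of the slab and the last factor
    bounds the volume of its base.\<close>
  define m where "m = (1/5) ^ (?n + 1) * (\<epsilon> / 8 * (?\<omega> * (d / R)))"
  have m: "m > 0" unfolding m_def using \<omega> \<epsilon> d R by simp
  have fr: "contact (fst t) (snd t)" "cap_frame (fst t) (snd t) (b t) (r t) (g t)" "orthonormal_frame (b t)"
    "\<And>i. i \<in> Basis \<Longrightarrow> r t i > 0" if "t \<in> X" for t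
    using X that \<delta>(1) unfolding framed_def cap_frame_def by fastforce+
  have Kd: "Kd \<noteq> {}" using K_subset_Kd \<open>K \<noteq> {}\<close> by auto
  have Hc: "continuous_on UNIV H" unfolding H_def by (rule continuous_on_support_function[OF compact_Kd Kd])
  have T: "T \<in> lmeasurable"
    unfolding T_def by (intro lmeasurable_compact compact_graph_slab Hc compact_cball)
  have "measure lebesgue T = \<epsilon> * measure lebesgue (cball (0::'a) 1)"
    unfolding T_def using \<epsilon> by (intro measure_graph_slab Hc compact_cball) auto
  then have Tm: "measure lebesgue T = \<epsilon> * ?\<omega>" by (simp add: content_cball)
  have slab_alt: "slab t = {(v, s). v \<in> frame_box (b t) (\<lambda>i. \<delta> / (64 * real ?n * r t i)) \<and>
      (fst t + \<epsilon> *\<^sub>R snd t) \<bullet> v - \<epsilon>/16 \<le> s \<and> s \<le> (fst t + \<epsilon> *\<^sub>R snd t) \<bullet> v - \<epsilon>/16 + \<epsilon>/8}" for t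
    by (simp add: slab_def dual_slab_def)
  have reg_meas: "reg t \<in> lmeasurable" if "t \<in> X" for t
    unfolding reg_def slab_alt
    by (intro lmeasurable_compact compact_continuous_image continuous_intros compact_graph_slab compact_frame_box fr that)
  have reg_ge: "m \<le> measure lebesgue (reg t)" if t: "t \<in> X" for t
  proof -
    have pp: "(\<Prod>i\<in>Basis. r t i) > 0" using fr(4)[OF t] by (intro prod_pos) auto
    have "measure lebesgue (reg t) = (1/5) ^ (?n + 1) * measure lebesgue (slab t)"
      unfolding reg_def measure_lebesgue_affine by simp
    also have "measure lebesgue (slab t) = \<epsilon> / 8 * measure lebesgue (frame_box (b t) (\<lambda>i. \<delta> / (64 * real ?n * r t i)))"
      unfolding slab_alt using \<epsilon> fr[OF t] by (intro measure_graph_slab compact_frame_box continuous_intros) auto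
    finally have 1: "measure lebesgue (reg t) = (1/5) ^ (?n + 1) * (\<epsilon> / 8 * measure lebesgue (frame_box (b t) (\<lambda>i. \<delta> / (64 * real ?n * r t i))))" .
    have "?\<omega> / 4 ^ ?n * (\<Prod>i\<in>Basis. \<delta> / (64 * real ?n * r t i)) \<le> measure lebesgue (frame_box (b t) (\<lambda>i. \<delta> / (64 * real ?n * r t i)))"
      using fr[OF t] \<delta>(1) by (intro measure_frame_box_ge) auto
    moreover have "(\<Prod>i\<in>(Basis::'a set). \<delta> / (64 * real ?n * r t i)) = 4 ^ ?n * d / (\<Prod>i\<in>Basis. r t i)"
    proof -
      have "(\<Prod>i\<in>(Basis::'a set). \<delta> / (64 * real ?n * r t i)) = (\<Prod>i\<in>(Basis::'a set). 4 * (\<delta> / (256 * real ?n)) / r t i)"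
        by (intro prod.cong) (auto simp: field_simps)
      also have "\<dots> = (4 * (\<delta> / (256 * real ?n))) ^ ?n / (\<Prod>i\<in>Basis. r t i)" by (simp only: prod_dividef prod_constant)
      finally show ?thesis unfolding d_def by (simp only: power_mult_distrib)
    qed
    moreover have "d / R \<le> d / (\<Prod>i\<in>Basis. r t i)"
      using R(1)[OF t] d pp by (intro divide_left_mono) auto
    then have "?\<omega> * (d / R) \<le> ?\<omega> * (d / (\<Prod>i\<in>Basis. r t i))" using \<omega> by (intro mult_left_mono) auto
    ultimately have "?\<omega> * (d / R) \<le> measure lebesgue (frame_box (b t) (\<lambda>i. \<delta> / (64 * real ?n * r t i)))" by simp
    then show ?thesis unfolding 1 m_def using \<epsilon> by (intro mult_left_mono) auto
  qed
  have sym: "w \<in> symmetric_part dual_body (?z t)" if "t \<in> X" "w \<in> slab t" for t w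
    using dual_slab_symmetric_part[OF fr(1,2)[OF that(1)]] that(2) by (simp add: slab_def)
  have reg_sub: "reg t \<subseteq> T" if t: "t \<in> X" for t
  proof
    fix y assume "y \<in> reg t"
    then obtain w where w: "w \<in> slab t" "y = ?z t + (1/5) *\<^sub>R w" by (auto simp: reg_def add.commute)
    note s = symmetric_part_scale(1)[OF convex_dual_body sym[OF t w(1)]]
    have y: "y \<in> dual_body" "snd y < (fst t + \<epsilon> *\<^sub>R snd t) \<bullet> fst y"
      using symmetric_part_dual_body[OF fr(1)[OF t] s] w(2) by auto
    obtain v s where vs: "y = (v, s)" by (cases y)
    have v: "norm v \<le> 1" "\<And>x. x \<in> Kd \<Longrightarrow> v \<bullet> x \<le> s" using y(1) by (auto simp: vs dual_body_def)
    have "H v \<le> s" unfolding H_def using v by (intro cSUP_least Kd) auto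
    moreover have "s \<le> H v + \<epsilon>"
    proof -
      have k: "fst t \<in> Kd" "norm (snd t) = 1" using fr(1)[OF t] K_subset_Kd by (auto simp: contact_def)
      have "bdd_above ((\<lambda>y. v \<bullet> y) ` Kd)"
        by (intro bounded_imp_bdd_above compact_imp_bounded compact_continuous_image continuous_intros compact_Kd)
      then have "v \<bullet> fst t \<le> H v" unfolding H_def using k by (intro cSUP_upper)
      moreover have "\<epsilon> * (snd t \<bullet> v) \<le> \<epsilon> * 1"
        using norm_cauchy_schwarz[of "snd t" v] k v \<epsilon> by (intro mult_left_mono) auto
      ultimately show ?thesis using y(2) by (simp add: vs inner_add_left inner_commute[of v])
    qed
    ultimately show "y \<in> T" using v by (simp add: T_def vs)
  qed
  define conf where "conf t t' \<longleftrightarrow> \<not> disjnt (reg t) (reg t')" for t t'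
  have conf_sym: "conf t t' \<longleftrightarrow> conf t' t" for t t' by (auto simp: conf_def disjnt_sym)
  obtain F where F: "finite F" "F \<subseteq> X" "real (card F) \<le> measure lebesgue T / m"
    "\<And>t. t \<in> X \<Longrightarrow> \<exists>t'\<in>F. conf t t' \<or> conf t' t"
  proof (rule finite_maximal_selection[of X conf])
    show "conf t t" if "t \<in> X" for t
    proof -
      have "reg t \<noteq> {}" using reg_ge[OF that] m by auto
      then show ?thesis by (simp add: conf_def disjnt_def)
    qed
    fix F assume F: "finite F" "F \<subseteq> X" "pairwise (\<lambda>x y. \<not> conf x y \<and> \<not> conf y x) F"
    have "real (card F) * m \<le> measure lebesgue T"
    proof (rule card_packing_le[of _ reg])
      show "reg t \<in> lmeasurable" "reg t \<subseteq> T" "m \<le> measure lebesgue (reg t)" if "t \<in> F" for t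
        using that F(2) reg_meas[of t] reg_sub[of t] reg_ge[of t] by blast+
    qed (use F T in \<open>auto simp: conf_def pairwise_def\<close>)
    then show "real (card F) \<le> measure lebesgue T / m" using m by (simp add: pos_le_divide_eq)
  qed (rule that, assumption+)
  have Tm': "measure lebesgue T / m = R * (40 * 5 ^ ?n / d)"
    unfolding Tm m_def using less_imp_neq[OF \<omega>] \<epsilon> d R(2) by (simp add: field_simps power_divide)
  have sep: "\<exists>(k', u')\<in>F. dual_centre k' u' \<in> dual_body \<and>
        snd (dual_centre k' u') < (k + \<epsilon> *\<^sub>R u) \<bullet> fst (dual_centre k' u')" if ku: "(k, u) \<in> X" for k u
  proof -
    obtain t' where t': "t' \<in> F" "conf (k, u) t'" using F(4)[OF ku] conf_sym by blast
    have X': "t' \<in> X" using t' F(2) by blast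
    from t'(2) obtain w w' where w: "w \<in> slab (k, u)" "w' \<in> slab t'" "(1/5) *\<^sub>R w + dual_centre k u = (1/5) *\<^sub>R w' + ?z t'"
    proof -
      obtain y where y: "y \<in> reg (k, u)" "y \<in> reg t'" using t'(2) unfolding conf_def disjnt_def by blast
      obtain w where "w \<in> slab (k, u)" "y = (1/5) *\<^sub>R w + ?z (k, u)" using y(1) unfolding reg_def by blast
      moreover obtain w' where "w' \<in> slab t'" "y = (1/5) *\<^sub>R w' + ?z t'" using y(2) unfolding reg_def by blast
      ultimately show thesis using that[of w w'] by simp
    qed
    have eq: "dual_centre k u + w /\<^sub>R 5 = ?z t' + w' /\<^sub>R 5" using w(3) by (simp add: add.commute)
    \<comment> \<open>The third vector of the expansion lemma is 0, which singles out the centre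
      belonging to \<open>t'\<close>.\<close>
    have s: "(w - w' + 0) /\<^sub>R 5 \<in> symmetric_part dual_body (dual_centre k u)"
      using sym[OF ku w(1)] sym[OF X' w(2)] symmetric_part_scale(2)[OF convex_dual_body sym[OF X' w(2)]]
      by (intro macbeath_expansion[OF convex_dual_body _ _ _ eq]) auto
    have "dual_centre k u + (w - w' + 0) /\<^sub>R 5 = ?z t'" using eq by (simp add: algebra_simps)
    then show ?thesis
      using symmetric_part_dual_body[OF fr(1)[OF ku, simplified] s] t'(1) by (auto simp: case_prod_beta intro!: bexI[of _ t'])
  qed
  show ?thesis
  proof (rule that[of F])
    show "finite F" "F \<subseteq> X" by (rule F(1), rule F(2))
    show "real (card F) \<le> R * (40 * 5 ^ ?n / (\<delta> / (256 * real ?n)) ^ ?n)"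
      using F(3) unfolding Tm' d_def .
    show "\<exists>(k', u')\<in>F. dual_centre k' u' \<in> dual_body \<and>
        snd (dual_centre k' u') < (k + \<epsilon> *\<^sub>R u) \<bullet> fst (dual_centre k' u')" if "(k, u) \<in> X" for k u
      by (rule sep[OF that])
  qed
qed

text \<open>Pairs with a large product of side lengths are served by
  \<open>primal_selection\<close>, the others by \<open>dual_selection\<close>. The half-spaces
  found all contain \<open>Kd\<close> and together exclude every point at distance \<epsilon> along
  an outer normal of \<open>K\<close>; by convexity this excludes all points farther away.\<close>

lemma approximating_polytope:
  assumes K: "interior K \<noteq> {}"
    and Z: "finite Z" "sphere (0::'a) 1 \<subseteq> (\<Union>e\<in>Z. ball e (1/2))" and R: "R > 0"
  shows "\<exists>P. polytope P \<and> K \<subseteq> P \<and> hausdorff_dist K P \<le> \<epsilon> \<and>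
     real (card {F. F facet_of P}) \<le> real (card Z) * (measure lebesgue (Kd - interior K) /
        (unit_ball_vol (real DIM('a)) * (box_ratio DIM('a) / 20) ^ DIM('a) * R)) +
       R * (40 * 5 ^ DIM('a) / (\<delta> / (256 * real DIM('a))) ^ DIM('a))"
proof -
  have Kne: "K \<noteq> {}" using K interior_subset by blast
  have \<epsilon>: "\<epsilon> > 0" using \<delta> by linarith
  define X where "X = {t. contact (fst t) (snd t)}"
  have "\<forall>t. \<exists>f. t \<in> X \<longrightarrow> cap_frame (fst t) (snd t) (fst f) (fst (snd f)) (snd (snd f))"
    using ex_cap_frame by (simp add: X_def)
  then obtain f where f: "\<And>t. t \<in> X \<Longrightarrow> cap_frame (fst t) (snd t) (fst (f t)) (fst (snd (f t))) (snd (snd (f t)))"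
    by metis
  define b where "b t = fst (f t)" for t
  define r where "r t = fst (snd (f t))" for t
  define g where "g t = snd (snd (f t))" for t
  have fr: "framed Y b r g" if "Y \<subseteq> X" for Y
    using that f by (auto simp: framed_def X_def b_def r_def g_def)
  define X1 where "X1 = {t \<in> X. R \<le> (\<Prod>i\<in>Basis. r t i)}"
  define X2 where "X2 = {t \<in> X. (\<Prod>i\<in>Basis. r t i) \<le> R}"
  have X12: "X1 \<subseteq> X" "X2 \<subseteq> X" by (auto simp: X1_def X2_def)
  have p1: "R \<le> (\<Prod>i\<in>Basis. r t i)" if "t \<in> X1" for t using that by (simp add: X1_def)
  have p2: "(\<Prod>i\<in>Basis. r t i) \<le> R" if "t \<in> X2" for t using that by (simp add: X2_def)
  obtain F1 where F1: "finite F1" "F1 \<subseteq> X1"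
    "real (card F1) \<le> real (card Z) * (measure lebesgue (Kd - interior K) /
        (unit_ball_vol (real DIM('a)) * (box_ratio DIM('a) / 20) ^ DIM('a) * R))"
    "\<And>k u. (k, u) \<in> X1 \<Longrightarrow> \<exists>(k', u')\<in>F1. u' \<bullet> k' + \<delta> < u' \<bullet> (k + \<epsilon> *\<^sub>R u)"
    by (rule primal_selection[OF fr[OF X12(1)] R p1 Z], assumption, rule that, assumption+)
  obtain F2 where F2: "finite F2" "F2 \<subseteq> X2"
    "real (card F2) \<le> R * (40 * 5 ^ DIM('a) / (\<delta> / (256 * real DIM('a))) ^ DIM('a))"
    "\<And>k u. (k, u) \<in> X2 \<Longrightarrow> \<exists>(k', u')\<in>F2. dual_centre k' u' \<in> dual_body \<and>
        snd (dual_centre k' u') < (k + \<epsilon> *\<^sub>R u) \<bullet> fst (dual_centre k' u')"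
    by (rule dual_selection[OF fr[OF X12(2)] p2 R Kne], assumption, rule that, assumption+)
  have con: "contact k u" if "(k, u) \<in> F1 \<union> F2" for k u
    using that F1(2) F2(2) X12 by (auto simp: X_def)
  \<comment> \<open>Only members whose centre lies in \<open>dual_body\<close> yield half-spaces
    known to contain \<open>Kd\<close>.\<close>
  define F2' where "F2' = {t \<in> F2. dual_centre (fst t) (snd t) \<in> dual_body}"
  define h1 where "h1 t = {y. snd t \<bullet> y \<le> snd t \<bullet> fst t + \<delta>}" for t :: "'a \<times> 'a"
  define h2 where "h2 t = {y. fst (dual_centre (fst t) (snd t)) \<bullet> y \<le> snd (dual_centre (fst t) (snd t))}" for t :: "'a \<times> 'a"
  define \<H> where "\<H> = h1 ` F1 \<union> h2 ` F2'"
  define P where "P = \<Inter>\<H>"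
  have fin: "finite \<H>" using F1 F2 by (simp add: \<H>_def F2'_def)
  have half: "\<exists>a c. a \<noteq> 0 \<and> h = {x. a \<bullet> x \<le> c}" if "h \<in> \<H>" for h
    using that
  proof (unfold \<H>_def, elim UnE imageE)
    fix t assume t: "h = h1 t" "t \<in> F1"
    then have "snd t \<noteq> 0" using con[of "fst t" "snd t"] by (auto simp: contact_def)
    then show ?thesis using t by (auto simp: h1_def)
  next
    fix t assume t: "h = h2 t" "t \<in> F2'"
    then have "fst (dual_centre (fst t) (snd t)) \<noteq> 0"
      using con[of "fst t" "snd t"] by (auto simp: contact_def F2'_def dual_centre_def)
    then show ?thesis using t by (auto simp: h2_def)
  qed
  have "Kd \<subseteq> P"
    unfolding P_def \<H>_def h1_def h2_def
    using con contact_Kd by (auto simp: F2'_def dual_body_def case_prod_beta)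
  then have KP: "K \<subseteq> P" using K_subset_Kd by blast
  then have intP: "interior P \<noteq> {}" using K interior_mono by blast
  have poly: "polyhedron P" and facets: "card {F. F facet_of P} \<le> card \<H>"
    using facets_of_halfspace_intersection[OF fin half P_def intP] by auto
  have sep: "k + \<epsilon> *\<^sub>R u \<notin> P" if c: "contact k u" for k u
  proof -
    have "(k, u) \<in> X1 \<or> (k, u) \<in> X2" using c by (auto simp: X1_def X2_def X_def)
    then show ?thesis
    proof
      assume "(k, u) \<in> X1"
      then obtain t where "t \<in> F1" "snd t \<bullet> fst t + \<delta> < snd t \<bullet> (k + \<epsilon> *\<^sub>R u)"
        using F1(4)[of k u] by (auto simp: case_prod_beta)
      then have "h1 t \<in> \<H>" "k + \<epsilon> *\<^sub>R u \<notin> h1 t" by (auto simp: \<H>_def h1_def)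
      then show ?thesis unfolding P_def by blast
    next
      assume "(k, u) \<in> X2"
      then obtain t where "t \<in> F2'" "snd (dual_centre (fst t) (snd t)) < (k + \<epsilon> *\<^sub>R u) \<bullet> fst (dual_centre (fst t) (snd t))"
        using F2(4)[of k u] by (auto simp: case_prod_beta F2'_def)
      then have "h2 t \<in> \<H>" "k + \<epsilon> *\<^sub>R u \<notin> h2 t" by (auto simp: \<H>_def h2_def inner_commute)
      then show ?thesis unfolding P_def by blast
    qed
  qed
  have near: "infdist q K \<le> \<epsilon>" if q: "q \<in> P" for q
  proof (rule ccontr)
    assume far: "\<not> infdist q K \<le> \<epsilon>"
    obtain x where x: "x \<in> K" using Kne by blast
    \<comment> \<open>On the segment from \<open>K\<close> to \<open>q\<close> some point of
      \<open>P\<close> has distance exactly \<epsilon>. With its nearest point \<open>k\<close> in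
      \<open>K\<close> it has the form \<open>k + \<epsilon> u\<close> for an outer normal
      \<open>u\<close>, which was excluded.\<close>
    define \<gamma> where "\<gamma> s = (1 - s) *\<^sub>R x + s *\<^sub>R q" for s :: real
    have "continuous_on {0..1} (\<lambda>s. infdist (\<gamma> s) K)" unfolding \<gamma>_def by (intro continuous_intros)
    moreover have "infdist (\<gamma> 0) K \<le> \<epsilon>" "\<epsilon> \<le> infdist (\<gamma> 1) K" using x far \<epsilon> by (auto simp: \<gamma>_def)
    ultimately obtain s where s: "0 \<le> s" "s \<le> 1" "infdist (\<gamma> s) K = \<epsilon>"
      using IVT'[of "\<lambda>s. infdist (\<gamma> s) K" 0 \<epsilon> 1] by auto
    have "\<gamma> s \<in> P"
      unfolding \<gamma>_def using s x KP q by (intro convexD[OF polyhedron_imp_convex[OF poly]]) auto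
    have clK: "closed K" by (rule compact_imp_closed[OF compact])
    define k where "k = closest_point K (\<gamma> s)"
    define u where "u = (1/\<epsilon>) *\<^sub>R (\<gamma> s - k)"
    have k: "k \<in> K" unfolding k_def by (rule closest_point_in_set[OF clK Kne])
    have "infdist (\<gamma> s) K = dist (\<gamma> s) k"
    proof (rule antisym)
      show "infdist (\<gamma> s) K \<le> dist (\<gamma> s) k" by (rule infdist_le[OF k])
      show "dist (\<gamma> s) k \<le> infdist (\<gamma> s) K"
        unfolding infdist_notempty[OF Kne] k_def
        by (intro cINF_greatest Kne closest_point_le[OF clK])
    qed
    then have "norm u = 1" using s \<epsilon> by (simp add: u_def dist_norm)
    moreover have "u \<bullet> y \<le> u \<bullet> k" if "y \<in> K" for y
    proof -
      have "(\<gamma> s - k) \<bullet> (y - k) \<le> 0" unfolding k_def by (rule closest_point_dot[OF convex clK that])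
      then have "u \<bullet> (y - k) \<le> 0" using \<epsilon> by (simp add: u_def divide_le_0_iff)
      then show ?thesis by (simp add: inner_diff_right)
    qed
    ultimately have "contact k u" using k by (simp add: contact_def)
    moreover have "k + \<epsilon> *\<^sub>R u = \<gamma> s" using \<epsilon> by (simp add: u_def)
    ultimately show False using sep[of k u] \<open>\<gamma> s \<in> P\<close> by simp
  qed
  obtain B where B: "\<And>x. x \<in> K \<Longrightarrow> norm x \<le> B"
    using compact_imp_bounded[OF compact] by (auto simp: bounded_iff)
  have "bounded P"
  proof -
    have "norm q \<le> B + \<epsilon> + 1" if "q \<in> P" for q
    proof -
      \<comment> \<open>The extra 1 gives the strict inequality that produces a point from the
        infimum.\<close>
      have "infdist q K < \<epsilon> + 1" using near[OF that] by linarith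
      then obtain y where y: "y \<in> K" "dist q y < \<epsilon> + 1"
        unfolding infdist_notempty[OF Kne] by (subst (asm) cINF_less_iff) (auto simp: Kne)
      then show ?thesis using B[OF y(1)] norm_triangle_ineq2[of q y] by (simp add: dist_norm)
    qed
    then show ?thesis by (auto simp: bounded_iff)
  qed
  then have "polytope P" using poly by (simp add: polytope_eq_bounded_polyhedron)
  moreover have "hausdorff_dist K P \<le> \<epsilon>"
    unfolding hausdorff_dist_def
  proof (intro max.boundedI cSUP_least)
    show "setdist {x} P \<le> \<epsilon>" if "x \<in> K" for x
      using that KP \<epsilon> by (auto simp: setdist_sing_in_set)
    show "setdist {y} K \<le> \<epsilon>" if "y \<in> P" for y
      using near[OF that] by (simp add: infdist_eq_setdist)
  qed (use Kne KP in auto)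
  moreover have "card \<H> \<le> card F1 + card F2"
  proof -
    have "card \<H> \<le> card (h1 ` F1) + card (h2 ` F2')" unfolding \<H>_def by (rule card_Un_le)
    also have "\<dots> \<le> card F1 + card F2'"
      using F1(1) F2(1) by (intro add_mono card_image_le) (auto simp: F2'_def)
    also have "card F2' \<le> card F2" using F2(1) by (intro card_mono) (auto simp: F2'_def)
    finally show ?thesis by simp
  qed
  ultimately show ?thesis using facets F1(3) F2(3) KP
    by (intro exI[of _ P]) auto
qed

end

section \<open>The facet bound\<close>

text \<open>For this \<open>R\<close> both \<open>\<epsilon> * S / R\<close> and
  \<open>R / \<epsilon> ^ n\<close> equal the square root on the right.\<close>

lemma le_sqrt_of_balanced_sum:
  fixes S \<epsilon> a b :: real
  assumes S: "S > 0" and \<epsilon>: "\<epsilon> > 0" and n: "n \<ge> 1"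
    and N: "N \<le> a * (\<epsilon> * S / R) + b * (R / \<epsilon> ^ n)" and R: "R = sqrt (S * \<epsilon> ^ (n + 1))"
  shows "N \<le> (a + b) * sqrt (S / \<epsilon> ^ (n - 1))"
proof -
  obtain m where m: "n = Suc m" using n by (cases n) auto
  have R2: "R * R = S * \<epsilon> ^ (n + 1)" "R > 0" unfolding R using S \<epsilon> by auto
  define q where "q = sqrt (S / \<epsilon> ^ m)"
  have q: "q * q = S / \<epsilon> ^ m" "q > 0" unfolding q_def using S \<epsilon> by auto
  have "R = q * \<epsilon> ^ n"
  proof -
    have "(q * \<epsilon> ^ n) * (q * \<epsilon> ^ n) = S * \<epsilon> ^ (n + 1)"
    proof -
      have "(q * \<epsilon> ^ n) * (q * \<epsilon> ^ n) = (q * q) * (\<epsilon> ^ n * \<epsilon> ^ n)" by simp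
      then show ?thesis using \<epsilon> by (simp add: q m power_add)
    qed
    then have "(q * \<epsilon> ^ n)\<^sup>2 = R\<^sup>2" using R2 by (simp add: power2_eq_square)
    then show ?thesis using q R2 \<epsilon> by (simp add: power2_eq_iff_nonneg)
  qed
  moreover from this have "\<epsilon> * S / R = q"
  proof -
    have "S = q * q * \<epsilon> ^ m" using q \<epsilon> by simp
    then show ?thesis unfolding \<open>R = q * \<epsilon> ^ n\<close> using q(2) \<epsilon> by (simp add: m)
  qed
  ultimately show ?thesis using N \<epsilon> by (simp add: q_def m algebra_simps)
qed

theorem theorem1:
  assumes "DIM('a::euclidean_space) \<ge> 2"
  shows "\<exists>c > 0. \<forall>(K::'a set) (\<epsilon>::real).
           convex_body K \<and> \<epsilon> > 0 \<and> (\<forall>u::'a. norm u = 1 \<longrightarrow> width K u \<ge> \<epsilon>) \<longrightarrow>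
           (\<exists>P. polytope P \<and> K \<subseteq> P \<and> hausdorff_dist K P \<le> \<epsilon> \<and>
                real (card {F. F facet_of P})
                  \<le> (c * surface_diameter K / \<epsilon>) powr ((real DIM('a) - 1) / 2))"
proof -
  let ?n = "DIM('a)"
  let ?s = "real ?n - 1"
  have s: "?s > 0" using assms by simp
  \<comment> \<open>The net is chosen before \<open>K\<close>, so its cardinality may enter the
    constant.\<close>
  obtain Z where Z: "finite Z" "sphere (0::'a) 1 \<subseteq> (\<Union>e\<in>Z. ball e (1/2))"
    by (rule compactE_image[OF compact_sphere, of "sphere (0::'a) 1" "\<lambda>e. ball e (1/2)"]) auto
  define c0 where "c0 = box_ratio ?n"
  have c0: "c0 > 0" by (simp add: c0_def box_ratio_pos)
  \<comment> \<open>The three bounds give \<open>16 * \<delta> \<le> \<epsilon>\<close>, a \<delta>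
    below the inradius bound \<open>c0 * w / 2\<close>, and the last condition of
    \<open>offset_body\<close>, with \<open>1/3\<close> in place of \<open>1/2\<close> to make it
    strict.\<close>
  define \<alpha> where "\<alpha> = min (1/16) (min (c0 / 2) (1 / (3 * (2 + 10 / c0))))"
  have \<alpha>: "\<alpha> > 0" "\<alpha> \<le> 1/16" "\<alpha> \<le> c0 / 2" "(2 + 10 / c0) * \<alpha> < 1/2"
  proof -
    have p: "2 + 10 / c0 > 0" using c0 by (simp add: add_pos_pos)
    show "\<alpha> > 0" using c0 p by (simp add: \<alpha>_def)
    show "\<alpha> \<le> 1/16" "\<alpha> \<le> c0 / 2" by (auto simp: \<alpha>_def)
    have "\<alpha> \<le> 1 / (3 * (2 + 10 / c0))" by (simp add: \<alpha>_def)
    then have "(2 + 10 / c0) * \<alpha> \<le> (2 + 10 / c0) * (1 / (3 * (2 + 10 / c0)))" using p by (intro mult_left_mono) auto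
    also have "\<dots> = 1/3" using p by simp
    finally show "(2 + 10 / c0) * \<alpha> < 1/2" by simp
  qed
  define \<omega> where "\<omega> = unit_ball_vol (real ?n)"
  have \<omega>: "\<omega> > 0" unfolding \<omega>_def by (intro unit_ball_vol_pos) auto
  define cc where "cc = cauchy_const ?n"
  have cc: "cc > 0"
    unfolding cc_def cauchy_const_def using assms by (intro divide_pos_pos mult_pos_pos unit_ball_vol_pos) auto
  \<comment> \<open>\<open>a\<close> collects the constants of the count in the shell,
    \<open>b\<close> those of the count in the space of half-spaces.\<close>
  define a where "a = real (card Z) * (real ?n * 2 ^ ?n * \<alpha> * 4 * cc / c0) / (\<omega> * (c0 / 20) ^ ?n)"
  define b where "b = 40 * 5 ^ ?n / (\<alpha> / (256 * real ?n)) ^ ?n"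
  have ab: "a \<ge> 0" "b > 0"
    using c0 \<alpha> cc \<omega> by (auto simp: a_def b_def)
  have cball1: "convex_body (cball (0::'a) 1)" by (simp add: convex_body_def)
  have "surface_area (ball (0::'a) 1) = surface_area (cball (0::'a) 1)"
    by (simp add: surface_area_def)
  then have "surface_area (ball (0::'a) 1) > 0" "surface_area (ball (0::'a) 1) < \<infinity>"
    using surface_area_pos[OF assms cball1] surface_area_finite[OF cball1] by simp_all
  then obtain \<sigma> where \<sigma>: "surface_area (ball (0::'a) 1) = ennreal \<sigma>" "\<sigma> > 0"
    by (cases "surface_area (ball (0::'a) 1)") (auto simp: less_le)
  \<comment> \<open>Since \<open>S = (D / 2) powr ?s * \<sigma>\<close>, this choice makes
    \<open>(C * D / \<epsilon>) powr ?s\<close> the square of the facet bound.\<close>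
  define C where "C = (((a + b)\<^sup>2 * \<sigma>) powr (1 / ?s)) / 2"
  have C: "C > 0" using ab \<sigma> by (simp add: C_def add_nonneg_pos)
  have "\<exists>P. polytope P \<and> K \<subseteq> P \<and> hausdorff_dist K P \<le> \<epsilon> \<and>
                real (card {F. F facet_of P}) \<le> (C * surface_diameter K / \<epsilon>) powr (?s / 2)"
    if K: "convex_body K" and \<epsilon>: "\<epsilon> > 0" and width: "\<And>u. norm u = 1 \<Longrightarrow> \<epsilon> \<le> width K u" for K :: "'a set" and \<epsilon>
  proof -
    have K': "compact K" "convex K" "interior K \<noteq> {}" using K by (auto simp: convex_body_def)
    have Kne: "K \<noteq> {}" using K'(3) interior_subset by blast
    obtain S where S: "surface_area K = ennreal S" "S > 0"
      using surface_area_pos[OF assms K] surface_area_finite[OF K]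
      by (cases "surface_area K") (auto simp: less_le)
    \<comment> \<open>A direction of width below \<open>2 * w\<close> stands in for a minimiser, at
      the cost of a factor 2.\<close>
    define w where "w = (INF u\<in>sphere (0::'a) 1. width K u)"
    have sne: "sphere (0::'a) 1 \<noteq> {}" by simp
    have bdd: "bdd_below (width K ` sphere 0 1)" using width by (intro bdd_belowI[of _ \<epsilon>]) auto
    have w\<epsilon>: "\<epsilon> \<le> w" unfolding w_def using width by (intro cINF_greatest sne) auto
    have ww: "w \<le> width K u" if "norm u = 1" for u unfolding w_def using that by (intro cINF_lower bdd) auto
    have "w < 2 * w" using w\<epsilon> \<epsilon> by simp
    then obtain u where u: "norm u = 1" "width K u < 2 * w"
      unfolding w_def by (subst (asm) cINF_less_iff[OF sne bdd]) auto
    have "emeasure lebesgue K \<le> ennreal (cc * (2 * w)) * surface_area K"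
      unfolding cc_def
    proof (rule volume_le_width_surface[OF assms K'(1) u(1)])
      show "2 * w > 0" using w\<epsilon> \<epsilon> by simp
      show "u \<bullet> x - u \<bullet> y \<le> 2 * w" if "x \<in> K" "y \<in> K" for x y
      proof (rule width_attained[OF K'(1) Kne, of u])
        assume *: "\<And>x' y'. x' \<in> K \<Longrightarrow> y' \<in> K \<Longrightarrow> u \<bullet> x' - u \<bullet> y' \<le> width K u"
        show ?thesis using *[OF that] u(2) by linarith
      qed
    qed
    then have "ennreal (measure lebesgue K) \<le> ennreal (cc * (2 * w) * S)"
      using S w\<epsilon> \<epsilon> cc by (simp add: ennreal_mult emeasure_eq_measure2[OF lmeasurable_compact[OF K'(1)]])
    then have V: "measure lebesgue K \<le> cc * (2 * w) * S" using S w\<epsilon> \<epsilon> cc by (simp add: ennreal_le_iff)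
    obtain x where x: "cball x (c0 * w / 2) \<subseteq> K" using inball_of_width[OF K ww] unfolding c0_def by blast
    define \<delta> where "\<delta> = \<alpha> * \<epsilon>"
    interpret offset_body K \<delta> \<epsilon>
    proof
      show "0 < \<delta>" using \<alpha> \<epsilon> by (simp add: \<delta>_def)
      show "16 * \<delta> \<le> \<epsilon>" using \<alpha>(2) \<epsilon> by (simp add: \<delta>_def)
      show "(2 + 10 / box_ratio ?n) * \<delta> < \<epsilon> / 2"
        using mult_strict_right_mono[OF \<alpha>(4) \<epsilon>] by (simp add: \<delta>_def c0_def mult.assoc)
    qed (use K' in auto)
    have "\<alpha> * \<epsilon> \<le> (c0 / 2) * w" using \<alpha> w\<epsilon> \<epsilon> by (intro mult_mono) auto
    then have \<delta>r: "\<delta> \<le> c0 * w / 2" by (simp add: \<delta>_def)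
    have w0: "w > 0" using w\<epsilon> \<epsilon> by simp
    have shell: "measure lebesgue (Kd - interior K) \<le> (real ?n * 2 ^ ?n * \<alpha> * 4 * cc / c0) * (\<epsilon> * S)"
    proof -
      have "measure lebesgue (Kd - interior K) \<le> real ?n * 2 ^ ?n * (\<delta> / (c0 * w / 2)) * measure lebesgue K"
      proof (rule measure_offset_shell[OF K'(1,2) x])
        show "Kd - interior K \<in> lmeasurable"
          by (intro fmeasurable.Diff lmeasurable_compact[OF compact_Kd] fmeasurableD
              lmeasurable_interior compact_imp_bounded K'(1))
        show "Kd - interior K \<subseteq> {x + y |x y. x \<in> K \<and> y \<in> cball 0 \<delta>} - interior K" unfolding Kd_def ..
      qed (use c0 w0 \<delta>r \<delta>(1) in auto)
      also have "\<dots> \<le> real ?n * 2 ^ ?n * (\<delta> / (c0 * w / 2)) * (cc * (2 * w) * S)"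
        using V c0 w0 \<delta>(1) by (intro mult_left_mono) auto
      \<comment> \<open>The width cancels: it divides through the inradius and multiplies through
        the volume bound.\<close>
      also have "\<dots> = (real ?n * 2 ^ ?n * \<alpha> * 4 * cc / c0) * (\<epsilon> * S)"
        using c0 w0 by (simp add: \<delta>_def field_simps)
      finally show ?thesis .
    qed
    define R where "R = sqrt (S * \<epsilon> ^ (?n + 1))"
    have R: "R > 0" using S \<epsilon> by (simp add: R_def)
    obtain P where P: "polytope P" "K \<subseteq> P" "hausdorff_dist K P \<le> \<epsilon>"
      "real (card {F. F facet_of P}) \<le> real (card Z) * (measure lebesgue (Kd - interior K) /
        (\<omega> * (c0 / 20) ^ ?n * R)) + R * (40 * 5 ^ ?n / (\<delta> / (256 * real ?n)) ^ ?n)"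
      using approximating_polytope[OF K'(3) Z R] unfolding \<omega>_def c0_def by blast
    have "real (card Z) * (measure lebesgue (Kd - interior K) / (\<omega> * (c0 / 20) ^ ?n * R))
        \<le> real (card Z) * ((real ?n * 2 ^ ?n * \<alpha> * 4 * cc / c0) * (\<epsilon> * S) / (\<omega> * (c0 / 20) ^ ?n * R))"
      using \<omega> c0 R shell by (intro mult_left_mono divide_right_mono) auto
    also have "\<dots> = a * (\<epsilon> * S / R)" by (simp add: a_def)
    finally have 1: "real (card Z) * (measure lebesgue (Kd - interior K) / (\<omega> * (c0 / 20) ^ ?n * R)) \<le> a * (\<epsilon> * S / R)" .
    have 2: "R * (40 * 5 ^ ?n / (\<delta> / (256 * real ?n)) ^ ?n) = b * (R / \<epsilon> ^ ?n)"
    proof -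
      have "(\<delta> / (256 * real ?n)) ^ ?n = (\<alpha> / (256 * real ?n)) ^ ?n * \<epsilon> ^ ?n"
        unfolding \<delta>_def by (simp flip: power_mult_distrib)
      then show ?thesis by (simp add: b_def)
    qed
    have "real (card {F. F facet_of P}) \<le> a * (\<epsilon> * S / R) + b * (R / \<epsilon> ^ ?n)"
      using P(4) 1 2 by linarith
    then have "real (card {F. F facet_of P}) \<le> (a + b) * sqrt (S / \<epsilon> ^ (?n - 1))"
      using S \<epsilon> assms by (intro le_sqrt_of_balanced_sum[OF S(2) \<epsilon> _ _ R_def]) auto
    also have "\<dots> = (C * surface_diameter K / \<epsilon>) powr (?s / 2)"
    proof -
      define D where "D = surface_diameter K"
      have D: "D \<ge> 0" "S = (D / 2) powr ?s * \<sigma>"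
        using surface_diameter_spec[OF assms K] S \<sigma> by (auto simp: D_def simp flip: ennreal_mult)
      have "(C * D / \<epsilon>) powr ?s = (a + b)\<^sup>2 * (S / \<epsilon> ^ (?n - 1))"
      proof -
        have "C * D / \<epsilon> = (((a + b)\<^sup>2 * \<sigma>) powr (1 / ?s)) * ((D / 2) / \<epsilon>)" by (simp add: C_def)
        then have "(C * D / \<epsilon>) powr ?s = (((a + b)\<^sup>2 * \<sigma>) powr (1 / ?s)) powr ?s * ((D / 2) / \<epsilon>) powr ?s"
          by (simp only: powr_mult)
        also have "(((a + b)\<^sup>2 * \<sigma>) powr (1 / ?s)) powr ?s = (a + b)\<^sup>2 * \<sigma>"
          using s \<sigma> by (simp add: powr_powr)
        also have "((D / 2) / \<epsilon>) powr ?s = (D / 2) powr ?s / \<epsilon> powr ?s"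
          by (rule powr_divide)
        also have "\<epsilon> powr ?s = \<epsilon> ^ (?n - 1)"
          using \<epsilon> assms powr_realpow[of \<epsilon> "?n - 1"] by (simp add: of_nat_diff)
        finally show ?thesis using D by simp
      qed
      moreover have "(C * D / \<epsilon>) powr (?s / 2) = sqrt ((C * D / \<epsilon>) powr ?s)"
        using C D \<epsilon> by (simp add: powr_half_sqrt[symmetric] powr_powr)
      moreover have "sqrt ((a + b)\<^sup>2 * (S / \<epsilon> ^ (?n - 1))) = (a + b) * sqrt (S / \<epsilon> ^ (?n - 1))"
        using ab by (simp only: real_sqrt_mult real_sqrt_abs)
      ultimately show ?thesis unfolding D_def by (simp only:)
    qed
    finally show ?thesis using P by blast
  qed
  then show ?thesis using C by blast
qed

end
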